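(* Let $N,M$ be positive integers with $M>N$ and $N$ even, $t$ a complex parameter, and suppose $\langle L_{N-1},L_{N-2}\rangle_1\langle L_{N-3},L_{N-4}\rangle_1\neq0$. Choose monic polynomials $r_j$ of degree $j$ ($0\le j\le N-1$) that are independent of $t$ for $j<N-2$, and $r_j=\pi_{j,1}$ for $j=N-2,N-1$. Let $\mathbb{D}_{jk}=\langle r_j,r_k\rangle_1$, $\mu=\mathbb{D}^{-1}$, and $$S_1(x,y)=-\sum_{j,k=0}^{N-1}r_j(x)w(x)\mu_{jk}\,\epsilon(r_kw)(y).$$ Let $\pi_{N,1}=L_N-\frac{\langle L_N,L_{N-2}\rangle_1}{\langle L_{N-1},L_{N-2}\rangle_1}L_{N-1}$ and $\pi_{N+1,1}=L_{N+1}-\frac{\langle L_{N+1},L_{N-2}\rangle_1}{\langle L_{N-1},L_{N-2}\rangle_1}L_{N-1}+\frac{\langle L_{N+1},L_{N-1}\rangle_1}{\langle L_{N-1},L_{N-2}\rangle_1}L_{N-2}$. Then $$S_1(x,y)-K_2(x,y)=-\frac{M}{2h_{N-2,0}}\epsilon(\pi_{N,1}w)(y)L_{N-2}(x)w(x)+\Big(-\frac{M}{2h_{N-1,0}}\epsilon(\pi_{N+1,1}w)(y)+\frac{Mt-(M+N)}{2h_{N-1,0}}\epsilon(\pi_{N,1}w)(y)\Big)L_{N-1}(x)w(x),$$ where $$K_2(x,y)=\left(\frac{y(t-y)}{x(t-x)}\right)^{\frac12}w_0^{\frac12}(x)w_0^{\frac12}(y)\frac{L_N(x)L_{N-1}(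y)-L_N(y)L_{N-1}(x)}{h_{N-1,0}(x-y)}.$$
   Context: $w(x)=e^{-\frac{M}{2}x}x^{\frac{M-N-1}{2}}(t-x)^{-\frac12}$ (branch cut of $(t-x)^{-1/2}$ on $\arg(t-x)=\pi$); $w_0(x)=x^{M-N}e^{-Mx}$; $L_k$ is the monic polynomial of degree $k$ orthogonal on $(0,\infty)$ for $w_0$, and $h_{k,0}=\int_0^\infty L_k^2w_0\,dx$. $\epsilon(x)=\frac12\mathrm{sgn}(x)$, $\epsilon(f)(x)=\int_0^\infty\epsilon(x-y)f(y)\,dy$, and $\langle f,g\rangle_1=\int_0^\infty\int_0^\infty\epsilon(x-y)f(x)g(y)w(x)w(y)\,dx\,dy$ (contour deformed off $t$ if $t\in(0,\infty)$). Monic skew orthogonal polynomials $\pi_{j,1}$: monic of degree $j$ with, for $j=2m$ or $2m+1$, $\langle\pi_{j,1},y^i\rangle_1=0$ for $i=0,\ldots,2m-1$ ($\pi_{N-1,1}$ is determined up to adding a multiple of $\pi_{N-2,1}$; any choice). *)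

theory Defs
  imports "HOL-Analysis.Analysis" "HOL-Computational_Algebra.Polynomial"
begin

text \<open>Weight w(x) = e^{-Mx/2} x^{(M-N-1)/2} (t-x)^{-1/2}, with the principal branch
  of the complex power (branch cut on arg(t-x) = pi, Ln has imaginary part in (-pi,pi]).\<close>
definition wt :: "nat \<Rightarrow> nat \<Rightarrow> complex \<Rightarrow> real \<Rightarrow> complex" where
  "wt M N t x = complex_of_real (exp (- (real M / 2) * x) * x powr ((real M - real N - 1) / 2))
                 * (t - complex_of_real x) powr (- 1 / 2)"

definition w0 :: "nat \<Rightarrow> nat \<Rightarrow> real \<Rightarrow> real" where
  "w0 M N x = x ^ (M - N) * exp (- real M * x)"

definition monic_orth_family :: "nat \<Rightarrow> nat \<Rightarrow> (nat \<Rightarrow> real poly) \<Rightarrow> bool" where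
  "monic_orth_family M N L \<longleftrightarrow>
     (\<forall>k. degree (L k) = k \<and> lead_coeff (L k) = 1 \<and>
        (\<forall>i<k. (LINT x:{0<..}|lborel. poly (L k) x * x ^ i * w0 M N x) = 0))"

definition h0 :: "nat \<Rightarrow> nat \<Rightarrow> (nat \<Rightarrow> real poly) \<Rightarrow> nat \<Rightarrow> real" where
  "h0 M N L k = (LINT x:{0<..}|lborel. (poly (L k) x)\<^sup>2 * w0 M N x)"

definition epsf :: "real \<Rightarrow> real" where
  "epsf x = sgn x / 2"

definition epsop :: "(real \<Rightarrow> complex) \<Rightarrow> real \<Rightarrow> complex" where
  "epsop f x = (LINT y:{0<..}|lborel. complex_of_real (epsf (x - y)) * f y)"

definition skew1 :: "nat \<Rightarrow> nat \<Rightarrow> complex \<Rightarrow> (real \<Rightarrow> complex) \<Rightarrow> (real \<Rightarrow> complex) \<Rightarrow> complex" where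
  "skew1 M N t f g =
     (LINT y:{0<..}|lborel. LINT x:{0<..}|lborel.
        complex_of_real (epsf (x - y)) * f x * g y * wt M N t x * wt M N t y)"

definition pc :: "complex poly \<Rightarrow> real \<Rightarrow> complex" where
  "pc p x = poly p (complex_of_real x)"

definition Lc :: "(nat \<Rightarrow> real poly) \<Rightarrow> nat \<Rightarrow> real \<Rightarrow> complex" where
  "Lc L k x = complex_of_real (poly (L k) x)"

definition is_pi1 :: "nat \<Rightarrow> nat \<Rightarrow> complex \<Rightarrow> nat \<Rightarrow> complex poly \<Rightarrow> bool" where
  "is_pi1 M N t j p \<longleftrightarrow> degree p = j \<and> lead_coeff p = 1 \<and>
     (\<forall>i < 2 * (j div 2). skew1 M N t (pc p) (\<lambda>y. complex_of_real (y ^ i)) = 0)"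

definition DD :: "nat \<Rightarrow> nat \<Rightarrow> complex \<Rightarrow> (nat \<Rightarrow> complex poly) \<Rightarrow> nat \<Rightarrow> nat \<Rightarrow> complex" where
  "DD M N t R j k = skew1 M N t (pc (R j)) (pc (R k))"

definition S1 :: "nat \<Rightarrow> nat \<Rightarrow> complex \<Rightarrow> (nat \<Rightarrow> complex poly) \<Rightarrow> (nat \<Rightarrow> nat \<Rightarrow> complex)
                   \<Rightarrow> real \<Rightarrow> real \<Rightarrow> complex" where
  "S1 M N t R mu x y = - (\<Sum>j<N. \<Sum>k<N.
      pc (R j) x * wt M N t x * mu j k * epsop (\<lambda>z. pc (R k) z * wt M N t z) y)"

definition K2 :: "nat \<Rightarrow> nat \<Rightarrow> complex \<Rightarrow> (nat \<Rightarrow> real poly) \<Rightarrow> real \<Rightarrow> real \<Rightarrow> complex" where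
  "K2 M N t L x y =
     (complex_of_real (sqrt y) * (t - complex_of_real y) powr (1 / 2))
     / (complex_of_real (sqrt x) * (t - complex_of_real x) powr (1 / 2))
     * complex_of_real (sqrt (w0 M N x) * sqrt (w0 M N y)
         * (poly (L N) x * poly (L (N - 1)) y - poly (L N) y * poly (L (N - 1)) x)
         / (h0 M N L (N - 1) * (x - y)))"

definition piN :: "nat \<Rightarrow> nat \<Rightarrow> complex \<Rightarrow> (nat \<Rightarrow> real poly) \<Rightarrow> real \<Rightarrow> complex" where
  "piN M N t L x = Lc L N x
     - skew1 M N t (Lc L N) (Lc L (N - 2)) / skew1 M N t (Lc L (N - 1)) (Lc L (N - 2)) * Lc L (N - 1) x"

definition piN1 :: "nat \<Rightarrow> nat \<Rightarrow> complex \<Rightarrow> (nat \<Rightarrow> real poly) \<Rightarrow> real \<Rightarrow> complex" where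
  "piN1 M N t L x = Lc L (N + 1) x
     - skew1 M N t (Lc L (N + 1)) (Lc L (N - 2)) / skew1 M N t (Lc L (N - 1)) (Lc L (N - 2)) * Lc L (N - 1) x
     + skew1 M N t (Lc L (N + 1)) (Lc L (N - 1)) / skew1 M N t (Lc L (N - 1)) (Lc L (N - 2)) * Lc L (N - 2) x"

end

theory Submission
  imports Defs
begin

text \<open>
  Put \<open>W(x) = x (t - x) w(x)\<close>, so that \<open>w W = w\<^sub>0\<close>. For a polynomial \<open>p\<close> one has \<open>(p W)' = w \<cdot> D p\<close>
  with \<open>D p\<close> a polynomial of degree \<open>deg p + 2\<close> and leading coefficient \<open>M/2\<close> times that of \<open>p\<close>.
  Integration gives \<open>\<epsilon>(w D p) = p W\<close>, hence \<open>\<langle>D p, q\<rangle>\<^sub>1 = - \<integral> p q w\<^sub>0\<close>.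

  Dividing \<open>S\<^sub>1(x, y)\<close> by \<open>w(x)\<close> leaves the polynomial \<open>P\<close> in \<open>x\<close> of degree below \<open>N\<close>
  with \<open>\<langle>p, P\<rangle>\<^sub>1 = - \<epsilon>(p w)(y)\<close> for all \<open>p\<close> of degree below \<open>N\<close>. The claimed value \<open>Q\<close> also has
  degree below \<open>N\<close>. The polynomials \<open>D L\<^sub>k\<close> (\<open>k < N\<close>), corrected for \<open>k = N - 2, N - 1\<close> by
  multiples of \<open>\<pi>\<^sub>N\<close> and \<open>\<pi>\<^sub>N\<^sub>+\<^sub>1\<close> so as to have degree below \<open>N\<close>, pair with \<open>P\<close> and with \<open>Q\<close>
  to the same values, because \<open>\<pi>\<^sub>N\<close> and \<open>\<pi>\<^sub>N\<^sub>+\<^sub>1\<close> are skew orthogonal to all degrees below \<open>N\<close>.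
  So \<open>\<integral> L\<^sub>k (P - Q) w\<^sub>0 = 0\<close> for all \<open>k < N\<close>, and \<open>P = Q\<close>.
\<close>

section \<open>Algebra of the skew form\<close>

text \<open>Subtracting the right multiple of \<open>R m\<close> lowers the degree, so induction on
  the degree bound reaches 0. Only additivity is asked of \<open>F\<close>; vanishing on all
  multiples of each \<open>R j\<close> takes the place of homogeneity. It is applied with the
  orthogonal family, the monomials and the family \<open>r t\<close> in the role of
  \<open>R\<close>.\<close>

lemma linear_functional_eq_0_monic_basis:
  fixes F :: "'a::comm_ring_1 poly \<Rightarrow> 'b::ab_group_add" and R :: "nat \<Rightarrow> 'a poly"
  assumes add: "\<And>p q. F (p + q) = F p + F q"
    and smult: "\<And>c j. j < n \<Longrightarrow> F (smult c (R j)) = 0"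
    and monic: "\<And>j. j < n \<Longrightarrow> degree (R j) = j \<and> lead_coeff (R j) = 1"
    and "degree p < n"
  shows "F p = 0"
proof -
  have F0: "F 0 = 0"
    using add[of 0 0] by simp
  \<comment> \<open>The zero polynomial has degree 0, so it is allowed separately; at
    \<open>m = 0\<close> it is the only case.\<close>
  have "\<forall>p. p = 0 \<or> degree p < m \<longrightarrow> F p = 0" if "m \<le> n" for m
    using that
  proof (induction m)
    case 0
    then show ?case using F0 by simp
  next
    case (Suc m)
    show ?case
    proof (intro allI impI)
      fix p :: "'a poly" assume p: "p = 0 \<or> degree p < Suc m"
      define q where "q = p - smult (coeff p m) (R m)"
      have Rm: "degree (R m) = m" "coeff (R m) m = 1"
        using monic[of m] Suc.prems by auto
      have "degree q \<le> m"
        unfolding q_def using p Rm by (intro degree_diff_le) (auto intro: order_trans[OF degree_smult_le])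
      moreover have "coeff q m = 0"
        using Rm by (simp add: q_def)
      ultimately have "q = 0 \<or> degree q < m"
        by (metis le_neq_implies_less leading_coeff_0_iff)
      then have "F q = 0"
        using Suc by auto
      moreover have "p = q + smult (coeff p m) (R m)"
        by (simp add: q_def)
      ultimately show "F p = 0"
        using add smult[of m] Suc.prems by (metis Suc_le_lessD add_0)
    qed
  qed
  from this[of n] show ?thesis using assms(4) by auto
qed

text \<open>Separates the algebra from the analysis. \<open>I\<close> stands for integration against
  \<open>w0\<close>, \<open>B\<close> for the skew form, and \<open>D p\<close> for the derivative
  of \<open>p W\<close> divided by \<open>w\<close>. \<open>I_Stein\<close> records that the
  derivative of \<open>x f(x) w0(x)\<close> integrates to 0.\<close>

locale skew_orthogonal_setting =
  fixes I :: "complex poly \<Rightarrow> complex"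
    and B :: "complex poly \<Rightarrow> complex poly \<Rightarrow> complex"
    and D :: "complex poly \<Rightarrow> complex poly"
    and L :: "nat \<Rightarrow> complex poly"
    and h :: "nat \<Rightarrow> complex"
    and M N :: nat and t :: complex
  assumes M_pos: "M > 0" and N_ge_2: "N \<ge> 2"
    and I_add: "I (p + q) = I p + I q" and I_smult: "I (smult c p) = c * I p"
    and B_add_left: "B (p + q) r = B p r + B q r"
    and B_smult_left: "B (smult c p) q = c * B p q"
    and B_skew: "B p q = - B q p"
    and D_def: "D p = pderiv p * [:0, t, -1:]
      + p * [:(of_nat M - of_nat N + 1) * t / 2,
              - (of_nat M * t + of_nat M - of_nat N + 2) / 2, of_nat M / 2:]"
    and B_D: "B (D p) q = - I (p * q)"
    and L_degree: "degree (L k) = k" and L_monic: "coeff (L k) k = 1"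
    and L_orth: "degree q < k \<Longrightarrow> I (L k * q) = 0"
    and I_L_L: "I (L k * L k) = h k" and h_nonzero: "h k \<noteq> 0"
    and I_Stein: "I (f * [:of_nat M - of_nat N + 1, - of_nat M:] + pderiv f * [:0, 1:]) = 0"
begin

section \<open>Bilinearity and orthogonality\<close>

lemma I_0 [simp]: "I 0 = 0"
  using I_smult[of 0 0] by simp

lemma I_minus: "I (- p) = - I p"
  using I_smult[of "-1" p] by simp

lemma I_diff: "I (p - q) = I p - I q"
  using I_add[of p "- q"] by (simp add: I_minus)

lemma I_sum: "I (\<Sum>j\<in>A. f j) = (\<Sum>j\<in>A. I (f j))"
  by (induction A rule: infinite_finite_induct) (auto simp: I_add)

lemma B_self [simp]: "B p p = 0"
  using B_skew[of p p] by simp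

lemma B_add_right: "B r (p + q) = B r p + B r q"
  using B_skew[of r] B_add_left by simp

lemma B_smult_right: "B p (smult c q) = c * B p q"
  using B_skew[of p] B_smult_left by simp

lemma B_0_left [simp]: "B 0 p = 0" and B_0_right [simp]: "B p 0 = 0"
  using B_smult_left[of 0 0 p] B_smult_right[of p 0 0] by auto

lemma B_minus_left: "B (- p) q = - B p q"
  using B_smult_left[of "-1" p q] by simp

lemma B_minus_right: "B p (- q) = - B p q"
  using B_smult_right[of p "-1" q] by simp

lemma B_diff_left: "B (p - q) r = B p r - B q r"
  using B_add_left[of p "- q"] by (simp add: B_minus_left)

lemma B_diff_right: "B r (p - q) = B r p - B r q"
  using B_add_right[of r p "- q"] by (simp add: B_minus_right)

lemma B_sum_right: "B p (\<Sum>j\<in>A. f j) = (\<Sum>j\<in>A. B p (f j))"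
  by (induction A rule: infinite_finite_induct) (auto simp: B_add_right)

lemma B_D_right: "B p (D q) = I (q * p)"
  using B_skew[of p "D q"] B_D by simp

lemma D_add: "D (p + q) = D p + D q"
  by (simp only: D_def pderiv_add distrib_right ac_simps)

lemma L_orth': "q = 0 \<or> degree q < k \<Longrightarrow> I (L k * q) = 0"
  using L_orth by auto

lemma I_L_L_eq: "I (L j * L k) = (if j = k then h j else 0)"
proof (cases j k rule: linorder_cases)
  case less
  then show ?thesis using L_orth[of "L j" k] L_degree by (simp add: mult.commute)
next
  case greater
  then show ?thesis using L_orth[of "L k" j] L_degree by simp
qed (simp add: I_L_L)

text \<open>Removing the multiple of \<open>L k\<close> that carries the top coefficient leaves
  something of lower degree, which \<open>L k\<close> annihilates.\<close>

lemma I_L_degree_le: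
  assumes "degree q \<le> k"
  shows "I (L k * q) = coeff q k * h k"
proof -
  define r where "r = q - smult (coeff q k) (L k)"
  have "degree r \<le> k"
    unfolding r_def using assms L_degree
    by (intro degree_diff_le) (auto intro: order_trans[OF degree_smult_le])
  moreover have "coeff r k = 0"
    by (simp add: r_def L_monic)
  ultimately have "r = 0 \<or> degree r < k"
    by (metis le_neq_implies_less leading_coeff_0_iff)
  then have "I (L k * r) = 0" by (rule L_orth')
  then show ?thesis
    by (simp add: r_def algebra_simps I_diff I_smult I_L_L)
qed

text \<open>Testing against \<open>L k\<close> with \<open>k\<close> the degree of \<open>p\<close>
  already isolates the leading coefficient.\<close>

lemma eq_0_if_orth:
  assumes "degree p < n" "\<And>k. k < n \<Longrightarrow> I (L k * p) = 0"
  shows "p = 0"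
  using I_L_degree_le[of p "degree p"] assms h_nonzero by fastforce

section \<open>Division by the operator \<open>D\<close> and the subleading coefficients\<close>

lemma coeff_D:
  "coeff (D p) (Suc (Suc k)) = of_nat M / 2 * coeff p k
     - ((of_nat M * t + of_nat M - of_nat N + 2) / 2 + of_nat (Suc k)) * coeff p (Suc k)
     + ((of_nat M - of_nat N + 1) * t / 2 + of_nat (Suc (Suc k)) * t) * coeff p (Suc (Suc k))"
  unfolding D_def by (simp add: coeff_pderiv coeff_pCons field_simps)

lemma degree_D_le: "degree (D p) \<le> degree p + 2"
proof (rule degree_le, intro allI impI)
  fix i assume "degree p + 2 < i"
  then obtain k where "i = Suc (Suc k)" "degree p < k"
    by (metis add_2_eq_Suc' less_imp_Suc_add Suc_less_eq add_Suc_right less_add_Suc1)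
  then show "coeff (D p) i = 0"
    by (simp add: coeff_D coeff_eq_0)
qed

text \<open>\<open>D\<close> raises the degree by two and multiplies the leading coefficient by
  \<open>M / 2\<close>, which is nonzero. Division with remainder therefore works and leaves a
  linear remainder.\<close>

lemma D_decomposition:
  assumes "degree p < n + 2"
  shows "\<exists>q a b. p = D q + [:a, b:] \<and> (q = 0 \<or> degree q < n)"
  using assms
proof (induction n arbitrary: p)
  case 0
  then have "p = D 0 + [:coeff p 0, coeff p 1:]"
    by (auto simp: D_def poly_eq_iff coeff_pCons coeff_eq_0 split: nat.splits)
  then show ?case by blast
next
  case (Suc n)
  \<comment> \<open>Chosen so that \<open>D q0\<close> has the same coefficient as \<open>p\<close>
    in degree \<open>n + 2\<close>.\<close>
  define q0 where "q0 = monom (2 * coeff p (n + 2) / of_nat M) n"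
  have q0: "degree q0 \<le> n"
    by (simp add: q0_def degree_monom_le)
  have "degree (p - D q0) \<le> n + 2"
    using Suc.prems q0 degree_D_le[of q0] by (intro degree_diff_le) auto
  moreover have "coeff (p - D q0) (n + 2) = 0"
    using M_pos by (simp add: coeff_D q0_def)
  ultimately have "degree (p - D q0) < n + 2"
    by (metis le_neq_implies_less leading_coeff_0_iff degree_0 add_2_eq_Suc' zero_less_Suc)
  then obtain q a b where "p - D q0 = D q + [:a, b:]" "q = 0 \<or> degree q < n"
    using Suc.IH by blast
  then have "p = D (q0 + q) + [:a, b:]" "degree (q0 + q) < Suc n"
    using q0 by (auto simp: D_add algebra_simps intro!: le_imp_less_Suc degree_add_le)
  then show ?case by blast
qed

text \<open>The difference of coefficients is the diagonal recurrence coefficient of the family,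
  that is, the integral of \<open>x (L k)^2 w0\<close> divided by \<open>h k\<close>.
  \<open>I_Stein\<close> with \<open>f = L k * L k\<close> evaluates it.\<close>

lemma L_subleading:
  "of_nat M * (coeff ([:0, 1:] * L k) k - coeff (L (Suc k)) k)
     = 2 * of_nat k + 1 + of_nat M - of_nat N"
proof -
  have x: "I (L k * ([:0, 1:] * L k)) = (coeff ([:0, 1:] * L k) k - coeff (L (Suc k)) k) * h k"
  proof -
    \<comment> \<open>Replacing \<open>x L k\<close> by \<open>r\<close> does not change the pairing
      with \<open>L k\<close>, since \<open>L (Suc k)\<close> is orthogonal to \<open>L k\<close>;
      and \<open>r\<close> has degree at most \<open>k\<close>.\<close>
    define r where "r = [:0, 1:] * L k - L (Suc k)"
    have "degree r \<le> Suc k"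
      unfolding r_def using L_degree[of k] L_degree[of "Suc k"]
      by (intro degree_diff_le order_trans[OF degree_mult_le]) auto
    moreover have "coeff r (Suc k) = 0"
      by (simp add: r_def L_monic)
    ultimately have "degree r \<le> k"
      by (metis le_neq_implies_less leading_coeff_0_iff degree_0 less_Suc_eq_le zero_less_Suc)
    from I_L_degree_le[OF this] show ?thesis
      by (simp only: r_def I_diff I_L_L_eq right_diff_distrib coeff_diff) simp
  qed
  have x': "I (L k * ([:0, 1:] * pderiv (L k))) = of_nat k * h k"
  proof -
    have "degree ([:0, 1:] * pderiv (L k)) \<le> k"
      by (rule degree_le) (use L_degree[of k] in \<open>auto simp: coeff_pCons coeff_pderiv coeff_eq_0 split: nat.splits\<close>)
    moreover have "coeff ([:0, 1:] * pderiv (L k)) k = of_nat k"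
      by (auto simp: coeff_pCons coeff_pderiv L_monic split: nat.splits)
    ultimately show ?thesis
      using I_L_degree_le[of "[:0, 1:] * pderiv (L k)" k] by (simp only:)
  qed
  have "I ((L k * L k) * [:of_nat M - of_nat N + 1, - of_nat M:] + pderiv (L k * L k) * [:0, 1:])
      = I (smult (of_nat M - of_nat N + 1) (L k * L k)
          - smult (of_nat M) (L k * ([:0, 1:] * L k))
          + smult 2 (L k * ([:0, 1:] * pderiv (L k))))"
    by (rule arg_cong[of _ _ I], rule poly_ext) (simp add: pderiv_mult algebra_simps)
  also have "\<dots> = ((of_nat M - of_nat N + 1)
      - of_nat M * (coeff ([:0, 1:] * L k) k - coeff (L (Suc k)) k) + 2 * of_nat k) * h k"
    by (simp only: I_add I_diff I_smult x x' I_L_L) (simp add: algebra_simps)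
  finally have "(of_nat M - of_nat N + 1)
      - of_nat M * (coeff ([:0, 1:] * L k) k - coeff (L (Suc k)) k) + 2 * of_nat k = 0"
    using I_Stein h_nonzero by simp
  then show ?thesis by (simp add: algebra_simps)
qed

section \<open>Skew orthogonality in degrees \<open>N\<close> and \<open>N + 1\<close>\<close>

definition pi_even :: "complex poly" where
  "pi_even = L N - smult (B (L N) (L (N - 2)) / B (L (N - 1)) (L (N - 2))) (L (N - 1))"

definition pi_odd :: "complex poly" where
  "pi_odd = L (N + 1) - smult (B (L (N + 1)) (L (N - 2)) / B (L (N - 1)) (L (N - 2))) (L (N - 1))
     + smult (B (L (N + 1)) (L (N - 1)) / B (L (N - 1)) (L (N - 2))) (L (N - 2))"

text \<open>On the image of \<open>D\<close> the skew form becomes the pairing \<open>I\<close>,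
  where ordinary orthogonality applies.\<close>

lemma B_L_orth_D:
  assumes "k \<ge> N - 2" "q = 0 \<or> degree q < N - 2"
  shows "B (L k) (D q) = 0"
  using L_orth'[of q k] assms by (auto simp: B_D_right mult.commute)

text \<open>Modulo the image of \<^term>\<open>D\<close>, which is skew orthogonal to \<^term>\<open>L k\<close> for large \<^term>\<open>k\<close>,
  polynomials of degree below \<^term>\<open>N\<close> form a plane, and \<^term>\<open>L (N - 1)\<close>, \<^term>\<open>L (N - 2)\<close> give a
  nondegenerate pairing on it.\<close>
lemma B_eq_0_if_orth_D:
  assumes nz: "B (L (N - 1)) (L (N - 2)) \<noteq> 0"
    and f: "\<And>q. q = 0 \<or> degree q < N - 2 \<Longrightarrow> B f (D q) = 0"
    and fa: "B f (L (N - 1)) = 0" and fb: "B f (L (N - 2)) = 0"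
    and v: "degree v < N"
  shows "B f v = 0"
proof -
  have NN: "N - 2 + 2 = N" using N_ge_2 by simp
  \<comment> \<open>The pairing of \<open>g\<close> with the linear remainder
    \<open>a + b x\<close>; by \<open>split\<close> this is all that survives once \<open>g\<close>
    is skew orthogonal to \<open>D q\<close>.\<close>
  define l where "l = (\<lambda>g (a::complex) b. a * B g [:1:] + b * B g [:0, 1:])"
  have split: "B g (D q + [:a, b:]) = l g a b" if "B g (D q) = 0" for g q a b
  proof -
    have "[:a, b:] = smult a [:1:] + smult b [:0, 1:]" by simp
    then show ?thesis using that by (simp only: B_add_right B_smult_right l_def) simp
  qed
  obtain qa a1 a2 where a: "L (N - 1) = D qa + [:a1, a2:]" "qa = 0 \<or> degree qa < N - 2"
    using D_decomposition[of "L (N - 1)" "N - 2"] N_ge_2 NN L_degree by auto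
  obtain qb b1 b2 where b: "L (N - 2) = D qb + [:b1, b2:]" "qb = 0 \<or> degree qb < N - 2"
    using D_decomposition[of "L (N - 2)" "N - 2"] N_ge_2 NN L_degree by auto
  obtain qv v1 v2 where v': "v = D qv + [:v1, v2:]" "qv = 0 \<or> degree qv < N - 2"
    using D_decomposition[of v "N - 2"] NN v by auto
  define s where "s = B (L (N - 1)) (L (N - 2))"
  have "l (L (N - 1)) b1 b2 = s"
    using split[OF B_L_orth_D, of "N - 1" qb b1 b2] b by (simp add: s_def)
  moreover have "l (L (N - 1)) a1 a2 = 0"
    using split[OF B_L_orth_D, of "N - 1" qa a1 a2] a by (metis B_self diff_le_mono2 one_le_numeral)
  \<comment> \<open>The remainders of \<open>L (N - 1)\<close> and \<open>L (N - 2)\<close> are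
    independent: their determinant times the determinant of the pairings with \<open>1\<close> and
    \<open>x\<close> is \<open>s * s\<close>.\<close>
  ultimately have det: "a1 * b2 - a2 * b1 \<noteq> 0"
  proof -
    assume A: "l (L (N - 1)) b1 b2 = s" "l (L (N - 1)) a1 a2 = 0"
    have A': "l (L (N - 2)) b1 b2 = 0"
      using split[OF B_L_orth_D, of "N - 2" qb b1 b2] b by (metis B_self order_refl)
    have A'': "l (L (N - 2)) a1 a2 = - s"
      using split[OF B_L_orth_D, of "N - 2" qa a1 a2] a B_skew[of "L (N - 2)" "L (N - 1)"]
      by (metis order_refl s_def)
    have "(a1 * b2 - a2 * b1) * (B (L (N - 1)) [:1:] * B (L (N - 2)) [:0, 1:]
            - B (L (N - 1)) [:0, 1:] * B (L (N - 2)) [:1:])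
        = l (L (N - 1)) a1 a2 * l (L (N - 2)) b1 b2 - l (L (N - 1)) b1 b2 * l (L (N - 2)) a1 a2"
      by (simp add: l_def algebra_simps)
    also have "\<dots> = s * s" using A A' A'' by simp
    finally show ?thesis using nz by (auto simp: s_def)
  qed
  have fa': "l f a1 a2 = 0" using split[OF f, of qa a1 a2] a fa by simp
  have fb': "l f b1 b2 = 0" using split[OF f, of qb b1 b2] b fb by simp
  \<comment> \<open>Cramer's rule for the values of \<open>B f\<close> on \<open>1\<close> and
    \<open>x\<close>.\<close>
  have "(a1 * b2 - a2 * b1) * B f [:1:] = b2 * l f a1 a2 - a2 * l f b1 b2"
    "(a1 * b2 - a2 * b1) * B f [:0, 1:] = a1 * l f b1 b2 - b1 * l f a1 a2"
    by (simp_all add: l_def algebra_simps)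
  then have "B f [:1:] = 0" "B f [:0, 1:] = 0"
    using det fa' fb' by simp_all
  then show ?thesis
    using split[OF f, of qv v1 v2] v' by (simp add: l_def)
qed

lemma degree_L_minus_D_less:
  "degree (D (L (N - 2)) - smult (of_nat M / 2) (L N)) < N"
proof -
  have "degree (D (L (N - 2)) - smult (of_nat M / 2) (L N)) \<le> N"
    using degree_D_le[of "L (N - 2)"] L_degree N_ge_2
    by (intro degree_diff_le) (auto intro: order_trans[OF degree_smult_le])
  moreover have "coeff (D (L (N - 2)) - smult (of_nat M / 2) (L N)) N = 0"
  proof -
    obtain k where "N = Suc (Suc k)" using N_ge_2 by (metis add_2_eq_Suc le_Suc_ex)
    then show ?thesis by (simp add: coeff_D L_monic coeff_eq_0 L_degree)
  qed
  ultimately show ?thesis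
    using N_ge_2 by (metis le_neq_implies_less leading_coeff_0_iff degree_0 zero_less_numeral order_less_le_trans)
qed

text \<open>Needed because \<open>pi_even\<close> contains no \<open>L (N - 2)\<close> term that
  could correct its pairing with \<open>L (N - 1)\<close>. Such a term, with coefficient
  \<open>- \<kappa>\<close>, is added to form \<open>\<rho>\<close>, which is then skew orthogonal
  to all degrees below \<open>N\<close>. Modulo those degrees \<open>\<rho>\<close> equals
  \<open>2 / M\<close> times \<open>D (L (N - 2))\<close>, so \<open>B \<rho> \<rho> = 0\<close>
  makes \<open>I (L (N - 2) * \<rho>)\<close> vanish. That integral is
  \<open>- \<kappa> * h (N - 2)\<close>, hence \<open>\<kappa> = 0\<close>.\<close>

lemma B_LN_LN1:
  assumes nz: "B (L (N - 1)) (L (N - 2)) \<noteq> 0"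
  shows "B (L N) (L (N - 1)) = 0"
proof -
  define s where "s = B (L (N - 1)) (L (N - 2))"
  define \<kappa> where "\<kappa> = - B (L N) (L (N - 1)) / s"
  define \<rho> where "\<rho> = pi_even - smult \<kappa> (L (N - 2))"
  have s: "B (L (N - 2)) (L (N - 1)) = - s" "s \<noteq> 0"
    using B_skew[of "L (N - 2)" "L (N - 1)"] nz by (auto simp: s_def)
  have orth: "B \<rho> v = 0" if "degree v < N" for v
  proof (rule B_eq_0_if_orth_D[OF nz _ _ _ that])
    show "B \<rho> (D q) = 0" if "q = 0 \<or> degree q < N - 2" for q
      using that B_L_orth_D[of N q] B_L_orth_D[of "N - 1" q] B_L_orth_D[of "N - 2" q]
      by (simp add: \<rho>_def pi_even_def B_diff_left B_smult_left)
    show "B \<rho> (L (N - 1)) = 0" "B \<rho> (L (N - 2)) = 0"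
      using s by (simp_all add: \<rho>_def pi_even_def B_diff_left B_add_left B_smult_left \<kappa>_def
          flip: s_def del: One_nat_def)
  qed
  define v where "v = \<rho> - smult (2 / of_nat M) (D (L (N - 2)))"
  have "v = - smult (2 / of_nat M) (D (L (N - 2)) - smult (of_nat M / 2) (L N))
       - (smult (B (L N) (L (N - 2)) / B (L (N - 1)) (L (N - 2))) (L (N - 1))) - smult \<kappa> (L (N - 2))"
    using M_pos by (simp add: v_def \<rho>_def pi_even_def smult_diff_right)
  also have "degree \<dots> < N"
    using degree_L_minus_D_less L_degree N_ge_2
    by (intro degree_diff_less) (auto intro: le_less_trans[OF degree_smult_le])
  finally have "B \<rho> v = 0" by (rule orth)
  then have "B \<rho> (smult (2 / of_nat M) (D (L (N - 2)))) = 0"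
    by (simp add: v_def B_diff_right)
  then have "I (L (N - 2) * \<rho>) = 0"
    using M_pos by (simp add: B_smult_right B_D_right)
  moreover have "I (L (N - 2) * \<rho>) = - \<kappa> * h (N - 2)"
    using N_ge_2 by (simp add: \<rho>_def pi_even_def right_diff_distrib I_diff I_smult I_L_L_eq) arith
  ultimately show ?thesis
    using h_nonzero s by (simp add: \<kappa>_def)
qed

text \<open>The pairing with \<open>L (N - 2)\<close> vanishes by the choice of the coefficient, the
  one with \<open>L (N - 1)\<close> by \<open>B_LN_LN1\<close>.\<close>

lemma B_pi_even:
  assumes nz: "B (L (N - 1)) (L (N - 2)) \<noteq> 0" and v: "degree v < N"
  shows "B pi_even v = 0"
proof (rule B_eq_0_if_orth_D[OF nz _ _ _ v])
  show "B pi_even (D q) = 0" if "q = 0 \<or> degree q < N - 2" for q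
    using that B_L_orth_D[of N q] B_L_orth_D[of "N - 1" q]
    by (simp add: pi_even_def B_diff_left B_smult_left)
qed (use nz in \<open>simp_all add: pi_even_def B_diff_left B_smult_left B_LN_LN1 del: One_nat_def\<close>)

text \<open>Here the two correction terms are chosen to remove the pairings with
  \<open>L (N - 2)\<close> and \<open>L (N - 1)\<close> one by one.\<close>

lemma B_pi_odd:
  assumes nz: "B (L (N - 1)) (L (N - 2)) \<noteq> 0" and v: "degree v < N"
  shows "B pi_odd v = 0"
proof (rule B_eq_0_if_orth_D[OF nz _ _ _ v])
  show "B pi_odd (D q) = 0" if "q = 0 \<or> degree q < N - 2" for q
    using that B_L_orth_D[of "N + 1" q] B_L_orth_D[of "N - 1" q] B_L_orth_D[of "N - 2" q]
    by (simp add: pi_odd_def B_diff_left B_smult_left B_add_left)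
qed (use nz B_skew[of "L (N - 2)" "L (N - 1)"] in
     \<open>simp_all add: pi_odd_def B_diff_left B_smult_left B_add_left\<close>)

lemma degree_D_minus_pi_even: "degree (D (L (N - 2)) - smult (of_nat M / 2) pi_even) < N"
proof -
  have "D (L (N - 2)) - smult (of_nat M / 2) pi_even = (D (L (N - 2)) - smult (of_nat M / 2) (L N))
     + smult (of_nat M / 2 * (B (L N) (L (N - 2)) / B (L (N - 1)) (L (N - 2)))) (L (N - 1))"
    by (simp add: pi_even_def smult_diff_right)
  also have "degree \<dots> < N"
    using degree_L_minus_D_less L_degree N_ge_2
    by (intro degree_add_less) (auto intro: le_less_trans[OF degree_smult_le])
  finally show ?thesis .
qed

text \<open>The source of the factor \<open>M t - (M + N)\<close>. Subtracting \<open>M / 2\<close>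
  times \<open>L (N + 1)\<close> from \<open>D (L (N - 1))\<close> clears degree
  \<open>N + 1\<close> and leaves the coefficient \<open>- (M t - (M + N)) / 2\<close> in degree
  \<open>N\<close>, which the multiple of \<open>pi_even\<close> cancels.\<close>

lemma degree_D_minus_pi_odd:
  "degree (D (L (N - 1)) - smult (of_nat M / 2) pi_odd
     + smult ((of_nat M * t - of_nat (M + N)) / 2) pi_even) < N"
proof -
  define p where "p = D (L (N - 1)) - smult (of_nat M / 2) (L (N + 1))
     + smult ((of_nat M * t - of_nat (M + N)) / 2) (L N)"
  obtain k where k: "N = Suc (Suc k)" using N_ge_2 by (metis add_2_eq_Suc le_Suc_ex)
  have "degree p \<le> Suc N"
    unfolding p_def using degree_D_le[of "L (N - 1)"] L_degree N_ge_2
    by (intro degree_diff_le degree_add_le) (auto intro: order_trans[OF degree_smult_le])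
  moreover have "coeff p (Suc N) = 0"
    by (simp add: p_def k coeff_D L_monic coeff_eq_0 L_degree)
  moreover have "coeff p N = 0"
  proof -
    have L1: "coeff (L (Suc k)) (Suc k) = 1" "coeff (L (Suc (Suc k))) (Suc (Suc k)) = 1"
      "coeff (L (Suc k)) (Suc (Suc k)) = 0"
      by (simp_all add: L_monic coeff_eq_0 L_degree)
    \<comment> \<open>Two consecutive recurrence coefficients, whose sum telescopes to the
      difference of subleading coefficients of \<open>L (N - 1)\<close> and
      \<open>L (N + 1)\<close>.\<close>
    have "of_nat M * (coeff (L (Suc k)) k - coeff (L (Suc (Suc k))) (Suc k))
         = 2 * of_nat (Suc k) + 1 + of_nat M - of_nat N"
      "of_nat M * (coeff (L (Suc (Suc k))) (Suc k) - coeff (L (Suc (Suc (Suc k)))) (Suc (Suc k)))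
         = 2 * of_nat (Suc (Suc k)) + 1 + of_nat M - of_nat N"
      using L_subleading[of "Suc k"] L_subleading[of "Suc (Suc k)"] by simp_all
    then have "of_nat M * (coeff (L (Suc k)) k - coeff (L (Suc (Suc (Suc k)))) (Suc (Suc k)))
         = 2 * (of_nat M + of_nat N)"
      by (simp add: k algebra_simps)
    then show ?thesis
      by (simp add: p_def k coeff_D L1 field_simps)
  qed
  ultimately have p: "degree p < N"
    using N_ge_2 by (metis le_neq_implies_less leading_coeff_0_iff degree_0 less_Suc_eq_le
        zero_less_numeral order_less_le_trans)
  have "D (L (N - 1)) - smult (of_nat M / 2) pi_odd + smult ((of_nat M * t - of_nat (M + N)) / 2) pi_even
     = p + smult (of_nat M / 2 * (B (L (N + 1)) (L (N - 2)) / B (L (N - 1)) (L (N - 2)))) (L (N - 1))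
         - smult (of_nat M / 2 * (B (L (N + 1)) (L (N - 1)) / B (L (N - 1)) (L (N - 2)))) (L (N - 2))
         - smult ((of_nat M * t - of_nat (M + N)) / 2 * (B (L N) (L (N - 2)) / B (L (N - 1)) (L (N - 2)))) (L (N - 1))"
    by (simp add: pi_even_def pi_odd_def p_def smult_diff_right smult_add_right)
  also have "degree \<dots> < N"
    using p L_degree N_ge_2
    by (intro degree_add_less degree_diff_less) (auto intro: le_less_trans[OF degree_smult_le])
  finally show ?thesis .
qed

section \<open>The reproducing kernel of \<open>I\<close> on degrees below \<open>N\<close>\<close>

definition kernel :: "complex \<Rightarrow> complex poly" where
  "kernel y = (\<Sum>k<N. smult (poly (L k) y / h k) (L k))"

lemma degree_kernel: "degree (kernel y) < N"
  unfolding kernel_def using N_ge_2 L_degree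
  by (intro degree_sum_less) (auto intro: le_less_trans[OF degree_smult_le])

lemma I_L_kernel:
  assumes "j < N"
  shows "I (L j * kernel y) = poly (L j) y"
proof -
  have "I (L j * kernel y) = (\<Sum>k<N. if k = j then poly (L j) y else 0)"
    unfolding kernel_def sum_distrib_left I_sum
    by (rule sum.cong) (auto simp: I_smult I_L_L_eq h_nonzero)
  then show ?thesis using assms by simp
qed

lemma kernel_reproducing:
  assumes "degree p < N"
  shows "I (p * kernel y) = poly p y"
proof -
  have "I (p * kernel y) - poly p y = 0"
    by (rule linear_functional_eq_0_monic_basis[where F = "\<lambda>p. I (p * kernel y) - poly p y" and R = L and n = N])
       (use assms L_degree L_monic in \<open>auto simp: I_add I_smult distrib_right I_L_kernel\<close>)
  then show ?thesis by simp
qed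

text \<open>The top coefficients of both sides agree, so the difference \<open>G\<close> has degree
  below \<open>N\<close>. The reproducing property then shows that \<open>G\<close> is orthogonal to
  every \<open>L j\<close> with \<open>j < N\<close>, and the three-term recurrence does not
  enter.\<close>

lemma Christoffel_Darboux:
  "[:- y, 1:] * kernel y
     = smult (1 / h (N - 1)) (smult (poly (L (N - 1)) y) (L N) - smult (poly (L N) y) (L (N - 1)))"
proof -
  define G where "G = [:- y, 1:] * kernel y - smult (1 / h (N - 1))
     (smult (poly (L (N - 1)) y) (L N) - smult (poly (L N) y) (L (N - 1)))"
  have K: "coeff (kernel y) N = 0"
    using degree_kernel coeff_eq_0 by blast
  have K': "coeff (kernel y) (N - 1) = poly (L (N - 1)) y / h (N - 1)"
    using I_L_degree_le[of "kernel y" "N - 1"] I_L_kernel[of "N - 1" y] degree_kernel[of y] N_ge_2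
      h_nonzero[of "N - 1"]
    by (simp add: field_simps)
  have "degree G \<le> N"
    unfolding G_def using degree_kernel[of y] L_degree
    by (intro degree_diff_le order_trans[OF degree_mult_le] order_trans[OF degree_smult_le]) auto
  moreover have "coeff G N = 0"
  proof -
    obtain k where k: "N = Suc k" using N_ge_2 by (cases N) auto
    show ?thesis
      using K K' unfolding k by (simp add: G_def k L_monic coeff_eq_0 L_degree)
  qed
  ultimately have "degree G < N"
    using N_ge_2 by (metis le_neq_implies_less leading_coeff_0_iff degree_0 zero_less_numeral order_less_le_trans)
  moreover have "I (L j * G) = 0" if "j < N" for j
  proof -
    have G: "I (L j * G) = I ([:- y, 1:] * L j * kernel y)
        - 1 / h (N - 1) * (poly (L (N - 1)) y * I (L j * L N) - poly (L N) y * I (L j * L (N - 1)))"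
      by (simp only: G_def right_diff_distrib mult_smult_right I_diff I_smult mult.left_commute mult.assoc)
    show ?thesis
    proof (cases "j = N - 1")
      case False
      have "degree ([:- y, 1:] * L j) < N"
        using that False L_degree[of j] by (intro le_less_trans[OF degree_mult_le]) auto
      then show ?thesis
        using G that False kernel_reproducing[of "[:- y, 1:] * L j" y] by (simp add: I_L_L_eq)
    next
      case True
      \<comment> \<open>For \<open>j = N - 1\<close> the product \<open>(x - y) L j\<close> has
        degree \<open>N\<close>, out of reach of the reproducing property. Splitting off
        \<open>L N\<close>, which is orthogonal to the kernel, brings it back.\<close>
      define g where "g = [:- y, 1:] * L j - L N"
      have "degree g \<le> N"
        unfolding g_def using that True L_degree[of j] L_degree[of N]
        by (intro degree_diff_le order_trans[OF degree_mult_le]) auto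
      moreover have "coeff g N = 0"
      proof -
        obtain k where k: "N = Suc k" using N_ge_2 by (cases N) auto
        show ?thesis
          by (simp add: g_def True k L_monic coeff_eq_0 L_degree)
      qed
      ultimately have "degree g < N"
        using N_ge_2 by (metis le_neq_implies_less leading_coeff_0_iff degree_0 zero_less_numeral order_less_le_trans)
      then have "I (g * kernel y) = - poly (L N) y"
        by (subst kernel_reproducing) (simp_all add: g_def)
      moreover have "I (g * kernel y) = I ([:- y, 1:] * L j * kernel y)"
        by (simp add: g_def left_diff_distrib I_diff L_orth degree_kernel)
      ultimately show ?thesis
        using G that True h_nonzero[of "N - 1"] by (simp add: I_L_L_eq)
    qed
  qed
  ultimately have "G = 0" by (rule eq_0_if_orth)
  then show ?thesis by (simp add: G_def)
qed

text \<open>\<open>E p\<close> models the value of epsilon applied to \<open>p w\<close> at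
  \<open>y\<close>, and \<open>W\<close> models \<open>W(y)\<close>. Both \<open>P\<close> and the
  asserted polynomial are tested against \<open>L k\<close>; each test is rewritten as a skew
  pairing with one polynomial \<open>p\<close> of degree below \<open>N\<close>, and both give the
  same value.\<close>

lemma kernel_unique:
  assumes nz: "B (L (N - 1)) (L (N - 2)) \<noteq> 0"
    and E_add: "\<And>p q. E (p + q) = E p + E q" and E_smult: "\<And>c p. E (smult c p) = c * E p"
    and E_D: "\<And>p. E (D p) = W * poly p y"
    and P_degree: "degree P < N" and P: "\<And>p. degree p < N \<Longrightarrow> B p P = - E p"
  shows "P = smult W (kernel y) + smult (- of_nat M / (2 * h (N - 2)) * E pi_even) (L (N - 2))
    + smult (- of_nat M / (2 * h (N - 1)) * E pi_odd
        + (of_nat M * t - of_nat (M + N)) / (2 * h (N - 1)) * E pi_even) (L (N - 1))"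
    (is "P = ?Q")
proof -
  have E_diff: "E (p - q) = E p - E q" for p q
    using E_add[of "p - q" q] by simp
  have Q_degree: "degree ?Q < N"
    using degree_kernel[of y] L_degree N_ge_2
    by (intro degree_add_less) (auto intro: le_less_trans[OF degree_smult_le])
  have "P - ?Q = 0"
  proof (rule eq_0_if_orth)
    show deg: "degree (P - ?Q) < N"
      using P_degree Q_degree by (rule degree_diff_less)
    fix k assume k: "k < N"
    have IQ: "I (L k * ?Q) = W * poly (L k) y
        + (if k = N - 2 then - of_nat M / 2 * E pi_even else 0)
        + (if k = N - 1 then - of_nat M / 2 * E pi_odd + (of_nat M * t - of_nat (M + N)) / 2 * E pi_even else 0)"
      using h_nonzero N_ge_2
      by (simp only: distrib_left mult_smult_right I_add I_smult I_L_L_eq I_L_kernel[OF k])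
         (auto simp: field_simps)
    \<comment> \<open>\<open>p\<close> is \<^term>\<open>D (L k)\<close> brought back to degree below \<^term>\<open>N\<close> by elements of the radical.\<close>
    define p where "p = (if k = N - 2 then D (L k) - smult (of_nat M / 2) pi_even
       else if k = N - 1 then D (L (N - 1)) - smult (of_nat M / 2) pi_odd
         + smult ((of_nat M * t - of_nat (M + N)) / 2) pi_even
       else D (L k))"
    have p_degree: "degree p < N"
    proof -
      have "degree (D (L k)) < N" if "k \<noteq> N - 2" "k \<noteq> N - 1"
        using degree_D_le[of "L k"] L_degree[of k] that k by auto
      then show ?thesis
        unfolding p_def using degree_D_minus_pi_even degree_D_minus_pi_odd by auto
    qed
    \<comment> \<open>The added multiples of \<open>pi_even\<close> and \<open>pi_odd\<close> are
      invisible to \<open>v\<close>, so \<open>p\<close> pairs like \<open>D (L k)\<close>.\<close>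
    have Bp: "B p v = - I (L k * v)" if "degree v < N" for v
      using that nz B_pi_even B_pi_odd
      by (auto simp: p_def B_diff_left B_add_left B_smult_left B_D)
    \<comment> \<open>\<open>E\<close> does see the added multiples: they produce the
      \<open>L (N - 2)\<close> and \<open>L (N - 1)\<close> terms, while \<open>D (L k)\<close>
      produces the kernel term.\<close>
    have Ep: "E p = I (L k * ?Q)"
      unfolding IQ using N_ge_2 by (auto simp: p_def E_diff E_add E_smult E_D)
    have "I (L k * (P - ?Q)) = - B p (P - ?Q)"
      using Bp[OF deg] by simp
    also have "\<dots> = E p + B p ?Q"
      using P[OF p_degree] by (simp only: B_diff_right) simp
    also have "B p ?Q = - E p"
      using Bp[OF Q_degree] Ep by simp
    finally show "I (L k * (P - ?Q)) = 0" by simp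
  qed
  then show ?thesis by simp
qed

end

section \<open>The weight and its integrals\<close>

lemma wt_eq:
  "wt M N t x = of_real (exp (- (real M / 2) * x) * x powr ((real M - real N - 1) / 2))
     / csqrt (t - of_real x)"
proof -
  have "(t - of_real x) powr (- 1 / 2) = inverse (csqrt (t - of_real x))"
    unfolding csqrt_conv_powr by (simp flip: powr_minus)
  then show ?thesis
    by (simp only: wt_def divide_inverse)
qed

text \<open>This is \<open>x (t - x) w(x)\<close> with the powers collected, so that it stays
  continuous at \<open>x = t\<close>.\<close>

definition Wt :: "nat \<Rightarrow> nat \<Rightarrow> complex \<Rightarrow> real \<Rightarrow> complex" where
  "Wt M N t x = of_real (exp (- (real M / 2) * x) * x powr ((real M - real N + 1) / 2))
     * csqrt (t - of_real x)"

section \<open>The principal square root along a horizontal line\<close>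

lemma csqrt_of_real_max:
  "csqrt (of_real x) = of_real (sqrt (max x 0)) + \<i> * of_real (sqrt (max (- x) 0))"
  by (auto simp: csqrt_of_real' max_def)

text \<open>For real \<open>t\<close> the argument moves along the branch cut without crossing it;
  for nonreal \<open>t\<close> its imaginary part is a nonzero constant, so the cut is never
  met.\<close>

lemma continuous_on_csqrt_diff_of_real: "continuous_on A (\<lambda>x. csqrt (t - of_real x))"
proof (cases "t \<in> \<real>")
  case True
  then obtain r where r: "t = of_real r" by (auto elim: Reals_cases)
  have "csqrt (t - of_real x)
      = of_real (sqrt (max (r - x) 0)) + \<i> * of_real (sqrt (max (- (r - x)) 0))" for x
    by (simp add: r csqrt_of_real_max flip: of_real_diff)
  then show ?thesis
    by (simp only:) (intro continuous_intros)
next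
  case False
  then have "t - of_real x \<notin> \<real>\<^sub>\<le>\<^sub>0" for x
    using complex_is_Real_iff by (auto simp: complex_nonpos_Reals_iff)
  then show ?thesis
    by (intro continuous_at_imp_continuous_on ballI isCont_csqrt' continuous_intros) auto
qed

lemma has_vector_derivative_csqrt_diff_of_real:
  assumes "of_real x \<noteq> t"
  shows "((\<lambda>x. csqrt (t - of_real x)) has_vector_derivative - 1 / (2 * csqrt (t - of_real x))) (at x)"
proof (cases "t - of_real x \<in> \<real>\<^sub>\<le>\<^sub>0")
  case False
  then have "((\<lambda>z. csqrt (t - z)) has_field_derivative - 1 / (2 * csqrt (t - of_real x))) (at (of_real x))"
    by (auto intro!: derivative_eq_intros)
  then show ?thesis
    by (rule has_vector_derivative_real_field)
next
  case True
  define r where "r = Re t"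
  have r: "t = of_real r" "r < x"
    using True assms by (auto simp: complex_nonpos_Reals_iff r_def complex_eq_iff)
  \<comment> \<open>On the cut the root is \<open>\<i>\<close> times the root of a positive number,
    where the complex derivative is available.\<close>
  have csqrt_eq: "csqrt (t - of_real u) = \<i> * csqrt (of_real u - t)" if "u > r" for u
    using that by (simp add: r csqrt_of_real' flip: of_real_diff)
  have "of_real x - t \<notin> \<real>\<^sub>\<le>\<^sub>0"
    using r by (simp add: complex_nonpos_Reals_iff)
  then have "((\<lambda>z. \<i> * csqrt (z - t)) has_field_derivative \<i> * (1 / (2 * csqrt (of_real x - t)))) (at (of_real x))"
    by (auto intro!: derivative_eq_intros)
  then have "((\<lambda>u. \<i> * csqrt (of_real u - t)) has_vector_derivative \<i> * (1 / (2 * csqrt (of_real x - t)))) (at x)"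
    by (rule has_vector_derivative_real_field)
  moreover have "\<i> * (1 / (2 * csqrt (of_real x - t))) = - 1 / (2 * csqrt (t - of_real x))"
    using csqrt_eq[of x] r assms by (simp add: field_simps)
  ultimately show ?thesis
    using r csqrt_eq by (auto intro: has_vector_derivative_transform_within_open[of _ _ x "{r<..}"])
qed

text \<open>The fundamental theorem of calculus gives \<open>- F a\<close> for the integral over the
  tail from \<open>a\<close>. Up to a null set \<open>epsf (y - z)\<close> is \<open>1 / 2\<close>
  minus the indicator of the tail from \<open>y\<close>, so the total integral 0 leaves
  \<open>F y\<close>. The finite set \<open>S\<close> admits a point where \<open>F\<close> is
  continuous without being differentiable.\<close>

lemma integral_derivative_eq_0_and_epsop:
  fixes F f :: "real \<Rightarrow> complex"
  assumes S: "finite S" and cont: "continuous_on {0..} F"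
    and deriv: "\<And>x. 0 < x \<Longrightarrow> x \<notin> S \<Longrightarrow> (F has_vector_derivative f x) (at x)"
    and F0: "F 0 = 0" and lim: "(F \<longlongrightarrow> 0) at_top"
    and int: "set_integrable lborel {0<..} f"
  shows "(LINT x:{0<..}|lborel. f x) = 0"
    and "0 \<le> y \<Longrightarrow> epsop f y = F y"
proof -
  define g where "g = (\<lambda>x. indicat_real {0<..} x *\<^sub>R f x)"
  have g: "integrable lborel g"
    using int by (simp add: g_def set_integrable_def)
  have [measurable]: "g \<in> borel_measurable borel"
    using borel_measurable_integrable[OF g] by simp
  have tail: "(LINT x:{a..}|lborel. g x) = - F a" if a: "0 \<le> a" for a
  proof -
    have ga: "set_integrable lborel A g" if "A \<in> sets lborel" for A
      unfolding set_integrable_def using g integrable_mult_indicator[OF that g] by simp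
    have fin: "(LINT x:{a..b}|lborel. g x) = F b - F a" if b: "a \<le> b" for b
    proof -
      have "(g has_integral (F b - F a)) {a..b}"
      proof (rule fundamental_theorem_of_calculus_interior_strong[OF S b])
        show "continuous_on {a..b} F"
          using cont a by (auto elim: continuous_on_subset)
        show "(F has_vector_derivative g x) (at x)" if "x \<in> {a<..<b} - S" for x
          using deriv[of x] that a by (simp add: g_def)
      qed
      then show ?thesis
        by (simp add: set_borel_integral_eq_integral[OF ga] integral_unique)
    qed
    have "((\<lambda>b. LINT x:{a..b}|lborel. g x) \<longlongrightarrow> (LINT x:{a..}|lborel. g x)) at_top"
      by (rule tendsto_set_lebesgue_integral_at_top) (auto intro: ga)
    moreover have "eventually (\<lambda>b. F b - F a = (LINT x:{a..b}|lborel. g x)) at_top"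
      using eventually_ge_at_top[of a] by eventually_elim (simp add: fin)
    then have "((\<lambda>b. LINT x:{a..b}|lborel. g x) \<longlongrightarrow> 0 - F a) at_top"
      by (rule Lim_transform_eventually[rotated]) (intro tendsto_intros lim)
    ultimately show ?thesis
      using tendsto_unique[OF trivial_limit_at_top_linorder] by fastforce
  qed
  have "integral\<^sup>L lborel g = (LINT x:{0..}|lborel. g x)"
    unfolding set_lebesgue_integral_def
    by (rule Bochner_Integration.integral_cong) (auto simp: g_def indicator_def)
  then have int0: "integral\<^sup>L lborel g = 0"
    using tail[of 0] F0 by simp
  then show "(LINT x:{0<..}|lborel. f x) = 0"
    by (simp add: set_lebesgue_integral_def g_def)
  assume y: "0 \<le> y"
  have "epsop f y = (LINT z|lborel. of_real (epsf (y - z)) * g z)"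
    unfolding epsop_def set_lebesgue_integral_def
    by (rule Bochner_Integration.integral_cong) (auto simp: g_def)
  also have "\<dots> = (LINT z|lborel. (1 / 2) * g z - indicat_real {y..} z *\<^sub>R g z)"
  proof (rule integral_cong_AE)
    \<comment> \<open>At \<open>z = y\<close> the left factor is 0 and the right one is
      \<open>- 1 / 2\<close>, so equality holds only almost everywhere.\<close>
    show "AE z in lborel. of_real (epsf (y - z)) * g z = 1 / 2 * g z - indicat_real {y..} z *\<^sub>R g z"
      using AE_lborel_singleton[of y]
      by eventually_elim (auto simp: epsf_def sgn_if indicator_def)
  qed (auto simp: epsf_def)
  also have "\<dots> = (1 / 2) * (LINT z|lborel. g z) - (LINT z:{y..}|lborel. g z)"
    unfolding set_lebesgue_integral_def using g
    by (subst Bochner_Integration.integral_diff) (auto intro!: integrable_mult_indicator)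
  also have "\<dots> = F y"
    using int0 tail[OF y] by simp
  finally show "epsop f y = F y" .
qed

section \<open>Growth bounds, measurability and integrability\<close>

lemma pc_bound: "\<exists>C n. 0 \<le> C \<and> (\<forall>x\<ge>0. norm (pc p x) \<le> C * (1 + x) ^ n)"
proof (induction p)
  case 0
  show ?case by (rule exI[of _ 0]) (simp add: pc_def)
next
  case (pCons a p)
  then obtain C n where C: "0 \<le> C" "\<And>x. 0 \<le> x \<Longrightarrow> norm (pc p x) \<le> C * (1 + x) ^ n" by blast
  have "norm (pc (pCons a p) x) \<le> (norm a + C) * (1 + x) ^ Suc n" if x: "0 \<le> x" for x
  proof -
    have "norm (pc (pCons a p) x) \<le> norm a + x * norm (pc p x)"
      unfolding pc_def poly_pCons using x by (intro order_trans[OF norm_triangle_ineq]) (simp add: norm_mult)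
    also have "\<dots> \<le> norm a * (1 + x) ^ Suc n + (1 + x) * (C * (1 + x) ^ n)"
    proof (intro add_mono mult_mono)
      show "norm a \<le> norm a * (1 + x) ^ Suc n"
        using x one_le_power[of "1 + x" "Suc n"] by (intro mult_le_cancel_left1[THEN iffD2]) auto
    qed (use x C in auto)
    finally show ?thesis by (simp add: algebra_simps)
  qed
  then show ?case using C(1) by (intro exI[of _ "norm a + C"] exI[of _ "Suc n"]) auto
qed

lemma power_le_exp:
  fixes c :: real
  assumes "0 < c"
  shows "\<exists>C>0. \<forall>x\<ge>0. (1 + x) ^ n \<le> C * exp (c * x)"
proof -
  define K where "K = 1 + real (Suc n) / c"
  have "(1 + x) ^ n \<le> K ^ n * exp (c * x)" if x: "0 \<le> x" for x
  proof -
    \<comment> \<open>The factor \<open>1 + x\<close> is bounded by a constant times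
      \<open>e\<close>. Taking \<open>Suc n\<close> rather than \<open>n\<close> avoids division by
      zero, and costs nothing because \<open>1 \<le> e\<close>.\<close>
    define e where "e = exp (c * x / real (Suc n))"
    have e: "1 \<le> e" "1 + c * x / real (Suc n) \<le> e"
      using assms x by (auto simp: e_def)
    have "1 + x \<le> e + real (Suc n) / c * e"
    proof (rule add_mono)
      have "x = real (Suc n) / c * (c * x / real (Suc n))"
        using assms by (simp del: of_nat_Suc)
      also have "\<dots> \<le> real (Suc n) / c * e"
        using assms e by (intro mult_left_mono) auto
      finally show "x \<le> real (Suc n) / c * e" .
    qed (rule e)
    then have "(1 + x) ^ n \<le> (K * e) ^ n"
      using x by (intro power_mono) (auto simp: K_def algebra_simps)
    also have "\<dots> \<le> K ^ n * e ^ Suc n"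
      unfolding power_mult_distrib using e(1) assms
      by (intro mult_left_mono power_increasing) (auto simp: K_def)
    also have "e ^ Suc n = exp (c * x)"
      unfolding e_def by (subst exp_of_nat_mult[symmetric]) simp
    finally show ?thesis .
  qed
  moreover have "K > 0" using assms by (simp add: K_def add_pos_pos)
  ultimately show ?thesis by (intro exI[of _ "K ^ n"]) auto
qed

lemma pc_powr_exp_bound:
  assumes "0 \<le> a" "c < d"
  shows "\<exists>C\<ge>0. \<forall>x\<ge>0. norm (pc p x) * (exp (- d * x) * x powr a) \<le> C * exp (- c * x)"
proof -
  obtain C n where C: "0 \<le> C" "\<And>x. 0 \<le> x \<Longrightarrow> norm (pc p x) \<le> C * (1 + x) ^ n"
    using pc_bound by blast
  define m where "m = nat \<lceil>a\<rceil>"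
  obtain C' where C': "0 < C'" "\<And>x. 0 \<le> x \<Longrightarrow> (1 + x) ^ (n + m) \<le> C' * exp ((d - c) * x)"
    using power_le_exp[of "d - c" "n + m"] assms by auto
  have "norm (pc p x) * (exp (- d * x) * x powr a) \<le> C * C' * exp (- c * x)" if x: "0 \<le> x" for x
  proof -
    have "x powr a \<le> (1 + x) powr a"
      using x assms by (intro powr_mono2) auto
    also have "\<dots> \<le> (1 + x) powr real m"
      using x assms by (intro powr_mono) (auto simp: m_def)
    also have "\<dots> = (1 + x) ^ m"
      using x by (simp add: powr_realpow)
    finally have "norm (pc p x) * (exp (- d * x) * x powr a)
        \<le> (C * (1 + x) ^ n) * (exp (- d * x) * (1 + x) ^ m)"
      using x C by (intro mult_mono mult_nonneg_nonneg) auto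
    also have "\<dots> = C * exp (- d * x) * (1 + x) ^ (n + m)"
      by (simp add: power_add)
    also have "\<dots> \<le> C * exp (- d * x) * (C' * exp ((d - c) * x))"
      using x C C' by (intro mult_left_mono) auto
    also have "\<dots> = C * C' * exp (- c * x)"
      by (simp add: algebra_simps flip: exp_add)
    finally show ?thesis .
  qed
  then show ?thesis using C C' by (intro exI[of _ "C * C'"]) auto
qed

text \<open>The point 0 is left out because \<open>0 powr 0 = 0\<close>.\<close>

lemma pc_exp_bound:
  assumes "c < d"
  shows "\<exists>C\<ge>0. \<forall>x>0. norm (pc p x) * exp (- d * x) \<le> C * exp (- c * x)"
proof -
  obtain C where C: "0 \<le> C" "\<And>x. 0 \<le> x \<Longrightarrow> norm (pc p x) * (exp (- d * x) * x powr 0) \<le> C * exp (- c * x)"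
    using pc_powr_exp_bound[of 0 c d p] assms by auto
  have "norm (pc p x) * exp (- d * x) \<le> C * exp (- c * x)" if "0 < x" for x
    using C(2)[of x] that by simp
  then show ?thesis using C(1) by blast
qed

lemma set_integrable_lborel_nonneg:
  fixes f :: "real \<Rightarrow> real"
  assumes "f integrable_on S" "\<And>x. x \<in> S \<Longrightarrow> 0 \<le> f x" "f \<in> borel_measurable borel" "S \<in> sets borel"
  shows "set_integrable lborel S f"
proof -
  have "set_integrable lebesgue S f"
    using assms by (intro nonnegative_absolutely_integrable_1)
  then show ?thesis
    using assms unfolding set_integrable_def by (subst (asm) integrable_completion) auto
qed

lemma set_integrable_exp: "0 < c \<Longrightarrow> set_integrable lborel {0<..} (\<lambda>x. exp (- c * x) :: real)"
  using integrable_on_exp_minus_to_infinity[of c 0]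
  by (auto intro: set_integrable_subset[OF set_integrable_lborel_nonneg[of _ "{0..}"]])

lemma borel_measurable_pc [measurable]: "pc p \<in> borel_measurable borel"
  unfolding pc_def by (intro borel_measurable_continuous_onI continuous_intros)

lemma borel_measurable_wt [measurable]: "wt M N t \<in> borel_measurable borel"
proof -
  have [measurable]: "(\<lambda>x. csqrt (t - of_real x)) \<in> borel_measurable borel"
    by (intro borel_measurable_continuous_onI continuous_on_csqrt_diff_of_real)
  show ?thesis
    unfolding wt_eq[abs_def] by measurable
qed

lemma borel_measurable_epsf [measurable]: "epsf \<in> borel_measurable borel"
  unfolding epsf_def by measurable

lemma AE_of_real_neq: "AE x in lborel. of_real x \<noteq> (t :: complex)"
  using AE_lborel_singleton[of "Re t"] by eventually_elim auto

text \<open>If \<open>t\<close> lies on the half-line, \<open>w\<close> has an inverse square root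
  singularity there, which is integrable. Bounding \<open>norm (t - x)\<close> below by the distance
  from \<open>x\<close> to \<open>Re t\<close> treats every \<open>t\<close> alike.\<close>

lemma integrable_pc_wt:
  assumes "N < M"
  shows "set_integrable lborel {0<..} (\<lambda>x. pc p x * wt M N t x)"
proof -
  define c where "c = real M / 4"
  have c: "0 < c" using assms by (simp add: c_def)
  define k where "k = (\<lambda>u::real. indicat_real {0<..1} u * u powr (- 1 / 2))"
  have "set_integrable lborel {0..1} (\<lambda>u::real. u powr (- 1 / 2))"
    by (intro set_integrable_lborel_nonneg integrable_on_powr_from_0) auto
  then have "set_integrable lborel {0<..1} (\<lambda>u::real. u powr (- 1 / 2))"
    by (rule set_integrable_subset) auto
  then have k: "integrable lborel k"
    by (simp add: k_def set_integrable_def)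
  define \<tau> where "\<tau> = Re t"
  \<comment> \<open>Exponential decay away from \<open>\<tau>\<close>, plus one copy of the
    singularity \<open>k\<close> on either side of \<open>\<tau>\<close>. The factors
    \<open>1\<close> and \<open>-1\<close> match the affine substitution rule.\<close>
  define G where "G = (\<lambda>x. indicat_real {0<..} x * exp (- c * x) + (k (- \<tau> + 1 * x) + k (\<tau> + (- 1) * x)))"
  have G: "integrable lborel G"
    unfolding G_def using set_integrable_exp[OF c, unfolded set_integrable_def]
    by (intro Bochner_Integration.integrable_add lborel_integrable_real_affine k) auto
  obtain C where C: "0 \<le> C" "\<And>x. 0 \<le> x \<Longrightarrow> norm (pc p x) *
      (exp (- (real M / 2) * x) * x powr ((real M - real N - 1) / 2)) \<le> C * exp (- c * x)"
    using pc_powr_exp_bound[of "(real M - real N - 1) / 2" c "real M / 2" p] assms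
    by (auto simp: c_def)
  show ?thesis
    unfolding set_integrable_def
  proof (rule Bochner_Integration.integrable_bound)
    show "integrable lborel (\<lambda>x. C * G x)"
      using G by simp
    show "AE x in lborel. norm (indicat_real {0<..} x *\<^sub>R (pc p x * wt M N t x)) \<le> norm (C * G x)"
      using AE_lborel_singleton[of \<tau>]
    proof eventually_elim
      case (elim x)
      have k0: "0 \<le> k u" for u by (simp add: k_def)
      have G0: "0 \<le> G x" by (auto simp: G_def intro!: add_nonneg_nonneg k0)
      show ?case
      proof (cases "0 < x")
        case True
        define d where "d = \<bar>x - \<tau>\<bar>"
        have d: "0 < d" using elim by (simp add: d_def)
        have "d \<le> norm (t - of_real x)"
          using abs_Re_le_cmod[of "t - of_real x"] by (simp add: d_def \<tau>_def abs_minus_commute)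
        then have n: "sqrt d \<le> norm (csqrt (t - of_real x))" by simp
        have "norm (pc p x * wt M N t x)
            = norm (pc p x) * (exp (- (real M / 2) * x) * x powr ((real M - real N - 1) / 2))
              / norm (csqrt (t - of_real x))"
          using True by (simp add: wt_eq norm_mult norm_divide)
        also have "\<dots> \<le> (C * exp (- c * x)) / sqrt d"
          using C True d n by (intro frac_le) auto
        also have "\<dots> = C * (exp (- c * x) / sqrt d)" by simp
        also have "\<dots> \<le> C * G x"
        proof (rule mult_left_mono[OF _ C(1)])
          show "exp (- c * x) / sqrt d \<le> G x"
          proof (cases "d \<le> 1")
            case True
            have "exp (- c * x) / sqrt d \<le> 1 / sqrt d"
              using \<open>0 < x\<close> c d by (intro divide_right_mono) auto
            also have "\<dots> = d powr (- 1 / 2)"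
              using d by (simp add: powr_half_sqrt powr_minus_divide)
            also have "\<dots> \<le> k (- \<tau> + 1 * x) + k (\<tau> + (- 1) * x)"
              using d True by (cases "x > \<tau>") (auto simp: k_def d_def)
            also have "\<dots> \<le> G x" by (simp add: G_def)
            finally show ?thesis .
          next
            case False
            then have "exp (- c * x) / sqrt d \<le> exp (- c * x)"
              by (intro divide_le_eq[THEN iffD2]) auto
            also have "\<dots> \<le> G x"
              using \<open>0 < x\<close> k0 by (simp add: G_def add_nonneg_nonneg)
            finally show ?thesis .
          qed
        qed
        finally show ?thesis
          using True C(1) G0 by simp
      qed (use C G0 in auto)
    qed
  qed auto
qed

section \<open>Integration against \<open>w0\<close> and the derivative of
  \<open>p W\<close>\<close>

lemma w0_eq_wt_Wt:
  assumes "0 < x" "of_real x \<noteq> t" "N < M"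
  shows "Wt M N t x * wt M N t x = of_real (w0 M N x)"
proof -
  have "exp (- (real M / 2) * x) * exp (- (real M / 2) * x) = exp (- real M * x)"
    by (simp flip: exp_add)
  moreover have "x powr ((real M - real N + 1) / 2) * x powr ((real M - real N - 1) / 2) = x ^ (M - N)"
  proof -
    have "(real M - real N + 1) / 2 + (real M - real N - 1) / 2 = real (M - N)"
      using assms by (simp add: of_nat_diff field_simps)
    then show ?thesis
      using assms by (simp only: flip: powr_add powr_realpow)
  qed
  ultimately have "exp (- (real M / 2) * x) * x powr ((real M - real N + 1) / 2)
      * (exp (- (real M / 2) * x) * x powr ((real M - real N - 1) / 2)) = w0 M N x"
    by (simp add: w0_def ac_simps)
  then show ?thesis
    using assms(2) unfolding Wt_def wt_eq by (simp flip: of_real_mult)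
qed

lemma integrable_pc_w0:
  assumes "N < M"
  shows "set_integrable lborel {0<..} (\<lambda>x. pc p x * of_real (w0 M N x))"
proof -
  obtain C where C: "0 \<le> C" "\<And>x. 0 < x \<Longrightarrow> norm (pc (p * monom 1 (M - N)) x) *
      exp (- real M * x) \<le> C * exp (- (real M / 2) * x)"
    using pc_exp_bound[of "real M / 2" "real M" "p * monom 1 (M - N)"] assms by auto
  have "set_integrable lborel {0<..} (\<lambda>x. C * exp (- (real M / 2) * x))"
    using set_integrable_exp[of "real M / 2"] assms by simp
  then show ?thesis
    unfolding set_integrable_def
  proof (rule Bochner_Integration.integrable_bound)
    show "AE x in lborel. norm (indicat_real {0<..} x *\<^sub>R (pc p x * of_real (w0 M N x)))
        \<le> norm (indicat_real {0<..} x *\<^sub>R (C * exp (- (real M / 2) * x)))"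
      using C by (intro AE_I2) (auto simp: indicator_def w0_def pc_def poly_monom norm_mult norm_power mult_ac)
  qed (auto simp: w0_def)
qed

definition I0 :: "nat \<Rightarrow> nat \<Rightarrow> complex poly \<Rightarrow> complex" where
  "I0 M N p = (LINT x:{0<..}|lborel. pc p x * of_real (w0 M N x))"

lemma pc_add: "pc (p + q) x = pc p x + pc q x"
  and pc_smult: "pc (smult c p) x = c * pc p x"
  and pc_mult: "pc (p * q) x = pc p x * pc q x"
  and pc_diff: "pc (p - q) x = pc p x - pc q x"
  by (simp_all add: pc_def)

lemma I0_add: "N < M \<Longrightarrow> I0 M N (p + q) = I0 M N p + I0 M N q"
  unfolding I0_def pc_add distrib_right by (intro set_integral_add integrable_pc_w0)

lemma I0_smult: "I0 M N (smult c p) = c * I0 M N p"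
  unfolding I0_def pc_smult mult.assoc by simp

lemma has_vector_derivative_pc: "(pc p has_vector_derivative pc (pderiv p) x) (at x)"
  unfolding pc_def by (rule has_vector_derivative_real_field[OF poly_DERIV])

lemma tendsto_0_exp_bound:
  fixes F :: "real \<Rightarrow> complex"
  assumes "0 < c" "\<And>x. 0 \<le> x \<Longrightarrow> norm (F x) \<le> C * exp (- c * x)"
  shows "(F \<longlongrightarrow> 0) at_top"
proof (rule Lim_null_comparison)
  show "eventually (\<lambda>x. norm (F x) \<le> C * exp (- c * x)) at_top"
    using eventually_ge_at_top[of 0] by eventually_elim (rule assms)
  have "LIM x at_top. - c * x :> at_bot"
    using assms by (intro filterlim_tendsto_neg_mult_at_bot[OF tendsto_const]) (auto intro: filterlim_ident)
  then show "((\<lambda>x. C * exp (- c * x)) \<longlongrightarrow> 0) at_top"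
    by (intro tendsto_mult_right_zero filterlim_compose[OF exp_at_bot])
qed

lemma I0_Stein:
  assumes "N < M"
  shows "I0 M N (f * [:of_nat M - of_nat N + 1, - of_nat M:] + pderiv f * [:0, 1:]) = 0"
proof -
  \<comment> \<open>The antiderivative \<open>x f(x) w0(x)\<close>: the factor \<open>x\<close>
    makes it vanish at 0, the exponential at infinity.\<close>
  define F where "F = (\<lambda>x. pc f x * of_real (x ^ Suc (M - N) * exp (- real M * x)))"
  obtain C where C: "0 \<le> C" "\<And>x. 0 < x \<Longrightarrow> norm (pc (f * monom 1 (Suc (M - N))) x) *
      exp (- real M * x) \<le> C * exp (- (real M / 2) * x)"
    using pc_exp_bound[of "real M / 2" "real M" "f * monom 1 (Suc (M - N))"] assms by auto
  show ?thesis
    unfolding I0_def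
  proof (rule integral_derivative_eq_0_and_epsop(1)[where S = "{}" and F = F])
    show "continuous_on {0..} F"
      unfolding F_def pc_def by (intro continuous_intros)
    show "F 0 = 0" by (simp add: F_def)
    show "(F \<longlongrightarrow> 0) at_top"
    proof (rule tendsto_0_exp_bound[of "real M / 2" _ C])
      fix x :: real assume "0 \<le> x"
      then show "norm (F x) \<le> C * exp (- (real M / 2) * x)"
        using C(1) C(2)[of x]
        by (cases "x = 0") (auto simp: F_def pc_def poly_monom norm_mult norm_power mult_ac)
    qed (use assms in auto)
    show "set_integrable lborel {0<..} (\<lambda>x. pc (f * [:of_nat M - of_nat N + 1, - of_nat M:]
        + pderiv f * [:0, 1:]) x * of_real (w0 M N x))"
      by (rule integrable_pc_w0[OF assms])
    fix x :: real assume x: "0 < x"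
    have "((\<lambda>x. x ^ Suc (M - N) * exp (- real M * x)) has_real_derivative
        (real M - real N + 1 - real M * x) * w0 M N x) (at x)"
    proof -
      have "((\<lambda>x. x ^ Suc k * exp (- real M * x)) has_real_derivative
          real (Suc k) * x ^ k * exp (- real M * x) - real M * exp (- real M * x) * x ^ Suc k) (at x)" for k
        by (rule derivative_eq_intros refl)+ simp
      from this[of "M - N"] show ?thesis
        using assms by (simp add: w0_def of_nat_diff algebra_simps)
    qed
    then have "((\<lambda>x. of_real (x ^ Suc (M - N) * exp (- real M * x)) :: complex) has_vector_derivative
        of_real ((real M - real N + 1 - real M * x) * w0 M N x)) (at x)"
      by (intro has_vector_derivative_of_real) (simp add: has_real_derivative_iff_has_vector_derivative)
    then have "(F has_vector_derivative pc f x * of_real ((real M - real N + 1 - real M * x) * w0 M N x)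
        + pc (pderiv f) x * of_real (x ^ Suc (M - N) * exp (- real M * x))) (at x)"
      unfolding F_def by (intro has_vector_derivative_mult has_vector_derivative_pc)
    also have "pc f x * of_real ((real M - real N + 1 - real M * x) * w0 M N x)
        + pc (pderiv f) x * of_real (x ^ Suc (M - N) * exp (- real M * x))
      = pc (f * [:of_nat M - of_nat N + 1, - of_nat M:] + pderiv f * [:0, 1:]) x * of_real (w0 M N x)"
      by (simp add: pc_def w0_def algebra_simps)
    finally show "(F has_vector_derivative pc (f * [:of_nat M - of_nat N + 1, - of_nat M:]
        + pderiv f * [:0, 1:]) x * of_real (w0 M N x)) (at x)" .
  qed simp
qed

text \<open>The first factor is \<open>W / w = x (t - x)\<close>. The quadratic is
  \<open>W' / w\<close>, namely \<open>x (t - x)\<close> times the logarithmic derivative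
  \<open>- M / 2 + (M - N + 1) / (2 x) - 1 / (2 (t - x))\<close> of \<open>W\<close>.\<close>

definition DW :: "nat \<Rightarrow> nat \<Rightarrow> complex \<Rightarrow> complex poly \<Rightarrow> complex poly" where
  "DW M N t p = pderiv p * [:0, t, -1:]
      + p * [:(of_nat M - of_nat N + 1) * t / 2,
              - (of_nat M * t + of_nat M - of_nat N + 2) / 2, of_nat M / 2:]"

lemma has_vector_derivative_pc_Wt:
  assumes x: "0 < x" "of_real x \<noteq> t"
  shows "((\<lambda>x. pc p x * Wt M N t x) has_vector_derivative pc (DW M N t p) x * wt M N t x) (at x)"
proof -
  define b where "b = (real M - real N + 1) / 2"
  define e where "e = exp (- (real M / 2) * x)"
  define u where "u = x powr (b - 1)"
  define s where "s = csqrt (t - of_real x)"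
  have b: "(real M - real N - 1) / 2 = b - 1" by (simp add: b_def field_simps)
  have xb: "x powr b = x * u"
    using x by (simp add: u_def powr_diff)
  \<comment> \<open>Writing \<open>t\<close> as \<open>s * s + x\<close> turns the identity to be
    proved into one that is rational in \<open>s\<close>.\<close>
  have s: "s \<noteq> 0" "t = s * s + of_real x"
    using x by (simp_all add: s_def flip: power2_eq_square)
  have "((\<lambda>x. exp (- (real M / 2) * x) * x powr b) has_real_derivative
      e * u * (b - real M / 2 * x)) (at x)"
  proof -
    have "((\<lambda>x. exp (- (real M / 2) * x)) has_real_derivative - (real M / 2) * e) (at x)"
      unfolding e_def by (auto intro!: derivative_eq_intros)
    from DERIV_mult[OF this has_real_derivative_powr[OF x(1), of b]]
    show ?thesis
      unfolding xb e_def[symmetric] u_def[symmetric] by (simp add: algebra_simps)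
  qed
  then have "((\<lambda>x. of_real (exp (- (real M / 2) * x) * x powr b) :: complex) has_vector_derivative
      of_real (e * u * (b - real M / 2 * x))) (at x)"
    by (intro has_vector_derivative_of_real) (simp add: has_real_derivative_iff_has_vector_derivative)
  then have "((\<lambda>x. of_real (exp (- (real M / 2) * x) * x powr b) * csqrt (t - of_real x)) has_vector_derivative
      of_real (exp (- (real M / 2) * x) * x powr b) * (- 1 / (2 * csqrt (t - of_real x)))
      + of_real (e * u * (b - real M / 2 * x)) * csqrt (t - of_real x)) (at x)"
    using x by (intro has_vector_derivative_mult has_vector_derivative_csqrt_diff_of_real) auto
  from has_vector_derivative_mult[OF has_vector_derivative_pc[of p x] this]
  have "((\<lambda>x. pc p x * Wt M N t x) has_vector_derivative
      pc p x * (of_real (e * (x * u)) * (- 1 / (2 * s)) + of_real (e * u * (b - real M / 2 * x)) * s)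
      + pc (pderiv p) x * (of_real (e * (x * u)) * s)) (at x)"
    unfolding Wt_def b_def[symmetric] s_def[symmetric] e_def[symmetric] xb .
  also have "pc p x * (of_real (e * (x * u)) * (- 1 / (2 * s)) + of_real (e * u * (b - real M / 2 * x)) * s)
      + pc (pderiv p) x * (of_real (e * (x * u)) * s)
    = pc (DW M N t p) x * (of_real (e * u) / s)"
  proof -
    have "pc (DW M N t p) x = pc (pderiv p) x * (of_real x * (s * s)) + pc p x *
        ((of_real b - of_nat M / 2 * of_real x) * (s * s) - of_real x / 2)"
      unfolding s(2) DW_def by (simp add: pc_def b_def field_simps)
    then show ?thesis using s(1) by (simp only:) (simp add: field_simps)
  qed
  also have "of_real (e * u) / s = wt M N t x"
    by (simp add: wt_eq e_def u_def s_def b)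
  finally show ?thesis .
qed

lemma epsop_DW:
  assumes "N < M" "0 \<le> y"
  shows "epsop (\<lambda>x. pc (DW M N t p) x * wt M N t x) y = pc p y * Wt M N t y"
proof (rule integral_derivative_eq_0_and_epsop(2)[where S = "{Re t}" and F = "\<lambda>y. pc p y * Wt M N t y"])
  show "continuous_on {0..} (\<lambda>y. pc p y * Wt M N t y)"
    unfolding pc_def Wt_def using assms
    by (intro continuous_intros continuous_on_csqrt_diff_of_real continuous_on_powr') auto
  show "pc p 0 * Wt M N t 0 = 0"
    by (simp add: Wt_def)
  show "set_integrable lborel {0<..} (\<lambda>x. pc (DW M N t p) x * wt M N t x)"
    by (rule integrable_pc_wt[OF assms(1)])
  show "((\<lambda>x. pc p x * Wt M N t x) has_vector_derivative pc (DW M N t p) x * wt M N t x) (at x)"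
    if "0 < x" "x \<notin> {Re t}" for x
    using that by (intro has_vector_derivative_pc_Wt) auto
  \<comment> \<open>The extra factor \<open>1 + norm t + x\<close> dominates the square root of
    \<open>norm (t - x)\<close>, so the bound for a polynomial times real powers applies.\<close>
  define q where "q = p * [:of_real (1 + norm t), 1:]"
  obtain C where C: "0 \<le> C" "\<And>x. 0 \<le> x \<Longrightarrow> norm (pc q x) *
      (exp (- (real M / 2) * x) * x powr ((real M - real N + 1) / 2)) \<le> C * exp (- (real M / 4) * x)"
    using pc_powr_exp_bound[of "(real M - real N + 1) / 2" "real M / 4" "real M / 2" q] assms by auto
  show "((\<lambda>y. pc p y * Wt M N t y) \<longlongrightarrow> 0) at_top"
  proof (rule tendsto_0_exp_bound[of "real M / 4" _ C])
    fix x :: real assume x: "0 \<le> x"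
    have "sqrt (norm (t - of_real x)) \<le> 1 + norm t + x"
    proof (rule real_le_lsqrt)
      have "norm (t - of_real x) \<le> norm t + x"
        using norm_triangle_ineq4[of t "of_real x"] x by simp
      also have "\<dots> \<le> (1 + norm t + x)\<^sup>2"
        using x by (simp add: power2_eq_square algebra_simps add_nonneg_nonneg)
      finally show "norm (t - of_real x) \<le> (1 + norm t + x)\<^sup>2" .
    qed (use x in auto)
    moreover have "norm (pc q x) = norm (pc p x) * (1 + norm t + x)"
    proof -
      have "pc q x = pc p x * of_real (1 + norm t + x)"
        by (simp add: q_def pc_def algebra_simps)
      then show ?thesis using x by (simp only: norm_mult norm_of_real) simp
    qed
    moreover define v where "v = exp (- (real M / 2) * x) * x powr ((real M - real N + 1) / 2)"
    moreover have "norm (Wt M N t x) = v * sqrt (norm (t - of_real x))"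
      unfolding Wt_def v_def[symmetric] by (simp add: norm_mult v_def)
    moreover have "0 \<le> v" by (simp add: v_def)
    ultimately have "norm (pc p x * Wt M N t x) \<le> norm (pc q x) * v"
      using mult_left_mono[of "sqrt (norm (t - of_real x))" "1 + norm t + x" "norm (pc p x) * v"]
      by (simp only: norm_mult mult_ac) simp
    then have "norm (pc p x * Wt M N t x)
        \<le> norm (pc q x) * (exp (- (real M / 2) * x) * x powr ((real M - real N + 1) / 2))"
      by (simp only: v_def)
    then show "norm (pc p x * Wt M N t x) \<le> C * exp (- (real M / 4) * x)"
      using C(2)[OF x] by linarith
  qed (use assms in auto)
qed (use assms in auto)

section \<open>The two bilinear forms\<close>

text \<open>Absolute integrability on the product space is what lets the iterated integral be split
  linearly and its order be exchanged.\<close>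

lemma integrable_epsf_product:
  fixes f g :: "real \<Rightarrow> complex"
  assumes f: "integrable lborel f" and g: "integrable lborel g"
  shows "integrable (lborel \<Otimes>\<^sub>M lborel) (\<lambda>(x, y). of_real (epsf (x - y)) * (f x * g y))"
proof -
  have [measurable]: "f \<in> borel_measurable borel" "g \<in> borel_measurable borel"
    using f g borel_measurable_integrable by force+
  have fg: "integrable (lborel \<Otimes>\<^sub>M lborel) (\<lambda>(x, y). f x * g y)"
  proof (rule lborel_pair.Fubini_integrable)
    show "integrable lborel (\<lambda>x. LINT y|lborel. norm (case (x, y) of (x, y) \<Rightarrow> f x * g y))"
      using f by (simp add: norm_mult)
    show "AE x in lborel. integrable lborel (\<lambda>y. case (x, y) of (x, y) \<Rightarrow> f x * g y)"
      using g by simp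
  qed measurable
  show ?thesis
  proof (rule Bochner_Integration.integrable_bound[OF fg])
    show "AE x in lborel \<Otimes>\<^sub>M lborel. norm (case x of (x, y) \<Rightarrow> of_real (epsf (x - y)) * (f x * g y))
        \<le> norm (case x of (x, y) \<Rightarrow> f x * g y)"
      by (intro AE_I2) (auto simp: norm_mult epsf_def sgn_if intro!: mult_left_le_one_le)
  qed measurable
qed

text \<open>Extension by zero to the whole line turns the set integrals of \<open>skew1\<close> into
  one integral over the product measure.\<close>

definition pw :: "nat \<Rightarrow> nat \<Rightarrow> complex \<Rightarrow> complex poly \<Rightarrow> real \<Rightarrow> complex" where
  "pw M N t p x = indicat_real {0<..} x *\<^sub>R (pc p x * wt M N t x)"

lemma integrable_pw: "N < M \<Longrightarrow> integrable lborel (pw M N t p)"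
  using integrable_pc_wt[of N M p t] by (simp add: set_integrable_def pw_def[abs_def])

lemma skew1_pc:
  assumes "N < M"
  shows "skew1 M N t (pc p) (pc q)
    = (\<integral>z. (case z of (x, y) \<Rightarrow> of_real (epsf (x - y)) * (pw M N t p x * pw M N t q y)) \<partial>(lborel \<Otimes>\<^sub>M lborel))"
proof -
  have "skew1 M N t (pc p) (pc q)
      = (LINT y|lborel. LINT x|lborel. of_real (epsf (x - y)) * (pw M N t p x * pw M N t q y))"
    unfolding skew1_def set_lebesgue_integral_def integral_scaleR_right[symmetric]
    by (intro Bochner_Integration.integral_cong refl) (auto simp: pw_def indicator_def)
  also have "\<dots> = (\<integral>z. (case z of (x, y) \<Rightarrow> of_real (epsf (x - y)) * (pw M N t p x * pw M N t q y)) \<partial>(lborel \<Otimes>\<^sub>M lborel))"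
    by (rule lborel_pair.integral_snd) (intro integrable_epsf_product integrable_pw assms)
  finally show ?thesis .
qed

lemma skew1_add_left:
  assumes "N < M"
  shows "skew1 M N t (pc (p + q)) (pc r) = skew1 M N t (pc p) (pc r) + skew1 M N t (pc q) (pc r)"
proof -
  have "(\<lambda>(x, y). of_real (epsf (x - y)) * (pw M N t (p + q) x * pw M N t r y))
      = (\<lambda>z. (case z of (x, y) \<Rightarrow> of_real (epsf (x - y)) * (pw M N t p x * pw M N t r y))
          + (case z of (x, y) \<Rightarrow> of_real (epsf (x - y)) * (pw M N t q x * pw M N t r y)))"
    by (auto simp: fun_eq_iff pw_def pc_add algebra_simps)
  then show ?thesis
    unfolding skew1_pc[OF assms]
    by (simp only: Bochner_Integration.integral_add integrable_epsf_product integrable_pw assms)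
qed

lemma skew1_smult_left:
  assumes "N < M"
  shows "skew1 M N t (pc (smult c p)) (pc q) = c * skew1 M N t (pc p) (pc q)"
proof -
  have "(\<lambda>(x, y). of_real (epsf (x - y)) * (pw M N t (smult c p) x * pw M N t q y))
      = (\<lambda>z. c * (case z of (x, y) \<Rightarrow> of_real (epsf (x - y)) * (pw M N t p x * pw M N t q y)))"
    by (auto simp: fun_eq_iff pw_def pc_smult)
  then show ?thesis
    unfolding skew1_pc[OF assms] by (simp only: integral_mult_right_zero)
qed

lemma epsf_minus: "epsf (x - y) = - epsf (y - x)"
  using sgn_minus[of "y - x"] by (simp add: epsf_def)

text \<open>Exchanging the two variables reverses the sign of \<open>epsf (x - y)\<close>.\<close>

lemma skew1_skew:
  assumes "N < M"
  shows "skew1 M N t (pc p) (pc q) = - skew1 M N t (pc q) (pc p)"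
proof -
  let ?f = "\<lambda>z. case z of (x, y) \<Rightarrow> of_real (epsf (x - y)) * (pw M N t q x * pw M N t p y)"
  have "?f \<in> borel_measurable (lborel \<Otimes>\<^sub>M lborel)"
    by (intro borel_measurable_integrable integrable_epsf_product integrable_pw assms)
  then have "skew1 M N t (pc q) (pc p) = (\<integral>z. (case z of (x, y) \<Rightarrow> ?f (y, x)) \<partial>(lborel \<Otimes>\<^sub>M lborel))"
    unfolding skew1_pc[OF assms] by (subst lborel_pair.integral_product_swap) auto
  also have "\<dots> = - skew1 M N t (pc p) (pc q)"
    unfolding skew1_pc[OF assms] integral_minus[symmetric]
    by (intro Bochner_Integration.integral_cong) (auto simp: mult.commute, subst epsf_minus, simp)
  finally show ?thesis by simp
qed

lemma borel_measurable_Wt [measurable]: "Wt M N t \<in> borel_measurable borel"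
proof -
  have [measurable]: "(\<lambda>x. csqrt (t - of_real x)) \<in> borel_measurable borel"
    by (intro borel_measurable_continuous_onI continuous_on_csqrt_diff_of_real)
  show ?thesis
    unfolding Wt_def[abs_def] by measurable
qed

text \<open>The inner integral is minus epsilon of \<open>w D p\<close> at \<open>y\<close>, since
  the arguments of \<open>epsf\<close> are reversed. By \<open>epsop_DW\<close> it equals
  \<open>- p W\<close>, and the remaining factor \<open>w\<close> turns \<open>W\<close> into
  \<open>w0\<close>.\<close>

lemma skew1_DW:
  assumes "N < M"
  shows "skew1 M N t (pc (DW M N t p)) (pc q) = - I0 M N (p * q)"
proof -
  let ?d = "\<lambda>x. pc (DW M N t p) x * wt M N t x"
  have inner: "(LINT x:{0<..}|lborel. of_real (epsf (x - y)) * pc (DW M N t p) x * pc q y * wt M N t x * wt M N t y)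
      = - (pc p y * Wt M N t y) * (pc q y * wt M N t y)" if "y \<in> {0<..}" for y
  proof -
    have "(LINT x:{0<..}|lborel. of_real (epsf (x - y)) * pc (DW M N t p) x * pc q y * wt M N t x * wt M N t y)
        = (LINT x:{0<..}|lborel. of_real (epsf (y - x)) * ?d x * (- pc q y * wt M N t y))"
      by (intro set_lebesgue_integral_cong) (auto simp: epsf_minus[of _ y])
    also have "\<dots> = epsop ?d y * (- pc q y * wt M N t y)"
      unfolding epsop_def by (rule set_integral_mult_left)
    also have "epsop ?d y = pc p y * Wt M N t y"
      using that by (intro epsop_DW assms) auto
    finally show ?thesis by simp
  qed
  have "skew1 M N t (pc (DW M N t p)) (pc q)
      = (LINT y:{0<..}|lborel. - (pc p y * Wt M N t y) * (pc q y * wt M N t y))"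
    unfolding skew1_def by (rule set_lebesgue_integral_cong) (simp, intro allI impI, rule inner)
  also have "\<dots> = (LINT y:{0<..}|lborel. - (pc (p * q) y * of_real (w0 M N y)))"
    unfolding set_lebesgue_integral_def
  proof (rule integral_cong_AE)
    \<comment> \<open>At \<open>y = t\<close> division by zero makes \<open>wt\<close> vanish and
      \<open>W w = w0\<close> fails, but this is a single point.\<close>
    show "AE y in lborel. indicat_real {0<..} y *\<^sub>R (- (pc p y * Wt M N t y) * (pc q y * wt M N t y))
        = indicat_real {0<..} y *\<^sub>R - (pc (p * q) y * of_real (w0 M N y))"
      using AE_of_real_neq[of t]
    proof eventually_elim
      case (elim y)
      show ?case
        using w0_eq_wt_Wt[of y t N M] elim assms by (auto simp: indicator_def pc_mult)
    qed
  qed (auto simp: w0_def)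
  also have "\<dots> = - I0 M N (p * q)"
    by (simp add: I0_def set_lebesgue_integral_def)
  finally show ?thesis .
qed

section \<open>The orthogonal family over the complex numbers, and the prefactor of
  \<open>K2\<close>\<close>

definition LC :: "(nat \<Rightarrow> real poly) \<Rightarrow> nat \<Rightarrow> complex poly" where
  "LC L k = map_poly of_real (L k)"

lemma pc_map_poly_of_real: "pc (map_poly of_real p) x = of_real (poly p x)"
  by (induction p) (auto simp: pc_def map_poly_pCons)

lemma pc_LC: "pc (LC L k) = Lc L k"
  by (rule ext) (simp add: LC_def Lc_def pc_map_poly_of_real)

lemma I0_LC_LC: "I0 M N (LC L k * LC L k) = of_real (h0 M N L k)"
  unfolding I0_def h0_def set_integral_complex_of_real[symmetric]
  by (intro set_lebesgue_integral_cong) (auto simp: pc_mult pc_LC Lc_def power2_eq_square)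

lemma h0_nonzero:
  assumes "N < M" "L k \<noteq> 0"
  shows "h0 M N L k \<noteq> 0"
proof
  assume h: "h0 M N L k = 0"
  let ?f = "\<lambda>x. indicat_real {0<..} x *\<^sub>R ((poly (L k) x)\<^sup>2 * w0 M N x)"
  have "integrable lborel (\<lambda>x. complex_of_real (?f x))"
    using integrable_pc_w0[OF assms(1), of "LC L k * LC L k"]
    unfolding set_integrable_def by (simp add: pc_mult pc_LC Lc_def power2_eq_square scaleR_conv_of_real)
  then have "integrable lborel ?f"
    by (simp only: complex_of_real_integrable_eq)
  moreover have "AE x in lborel. 0 \<le> ?f x"
    by (intro AE_I2) (auto simp: indicator_def w0_def)
  ultimately have "AE x in lborel. ?f x = 0"
    using h integral_nonneg_eq_0_iff_AE unfolding h0_def set_lebesgue_integral_def by blast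
  moreover have "AE x in lborel. x \<notin> {x. poly (L k) x = 0}"
    using assms(2) by (intro AE_not_in finite_imp_null_set_lborel poly_roots_finite)
  \<comment> \<open>On the unit interval the integrand is positive outside the finitely many roots,
    so vanishing almost everywhere would make the interval null.\<close>
  ultimately have "AE x in lborel. x \<notin> {0<..<1::real}"
    by eventually_elim (auto simp: w0_def)
  then have "emeasure lborel {0<..<1::real} = 0"
    by (subst (asm) AE_iff_measurable[of "{0<..<1}"]) auto
  then show False by simp
qed

lemma I0_LC_orth:
  assumes "N < M" "monic_orth_family M N L" "degree q < k"
  shows "I0 M N (LC L k * q) = 0"
proof (rule linear_functional_eq_0_monic_basis[where F = "\<lambda>q. I0 M N (LC L k * q)" and R = "monom 1" and n = k])
  show "I0 M N (LC L k * (p + q)) = I0 M N (LC L k * p) + I0 M N (LC L k * q)" for p q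
    by (simp add: distrib_left I0_add assms)
  show "degree (monom (1::complex) j) = j \<and> lead_coeff (monom (1::complex) j) = 1" for j
    by (simp add: degree_monom_eq)
  fix c j assume j: "j < k"
  have "I0 M N (LC L k * monom 1 j) = of_real (LINT x:{0<..}|lborel. poly (L k) x * x ^ j * w0 M N x)"
    unfolding I0_def set_integral_complex_of_real[symmetric]
    by (intro set_lebesgue_integral_cong) (auto simp: pc_mult pc_LC Lc_def, simp add: pc_def poly_monom)
  then show "I0 M N (LC L k * smult c (monom 1 j)) = 0"
    using assms(2) j by (simp add: I0_smult monic_orth_family_def)
qed (rule assms)

lemma sqrt_w0:
  assumes "0 < x" "N < M"
  shows "sqrt (w0 M N x) = exp (- (real M / 2) * x) * x powr ((real M - real N) / 2)"
proof (rule real_sqrt_unique)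
  have "exp (- (real M / 2) * x) ^ 2 = exp (- real M * x)"
    by (simp flip: exp_double)
  moreover have "(x powr ((real M - real N) / 2)) ^ 2 = x ^ (M - N)"
    using assms by (simp add: of_nat_diff power2_eq_square flip: powr_add powr_realpow)
  ultimately show "(exp (- (real M / 2) * x) * x powr ((real M - real N) / 2))\<^sup>2 = w0 M N x"
    by (simp only: power_mult_distrib w0_def mult.commute)
qed simp

text \<open>The factors in \<open>x\<close> combine to \<open>w(x)\<close> and those in
  \<open>y\<close> to \<open>W(y)\<close>, so \<open>K2\<close> is \<open>w(x) W(y)\<close> times
  the Christoffel-Darboux quotient.\<close>

lemma K2_prefactor:
  assumes "0 < x" "0 < y" "N < M"
  shows "(of_real (sqrt y) * (t - of_real y) powr (1 / 2)) / (of_real (sqrt x) * (t - of_real x) powr (1 / 2))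
      * of_real (sqrt (w0 M N x) * sqrt (w0 M N y)) = wt M N t x * Wt M N t y"
proof -
  have "sqrt y * sqrt (w0 M N y) = exp (- (real M / 2) * y) * y powr ((real M - real N + 1) / 2)"
  proof -
    have "sqrt y * y powr ((real M - real N) / 2) = y powr ((real M - real N + 1) / 2)"
      using assms by (simp add: add_divide_distrib powr_add powr_half_sqrt)
    then show ?thesis using assms by (simp add: sqrt_w0)
  qed
  moreover have "sqrt (w0 M N x) / sqrt x = exp (- (real M / 2) * x) * x powr ((real M - real N - 1) / 2)"
  proof -
    have "x powr ((real M - real N) / 2) / sqrt x = x powr ((real M - real N - 1) / 2)"
      using assms by (simp add: diff_divide_distrib[of _ 1] powr_diff powr_half_sqrt)
    then show ?thesis using assms by (simp add: sqrt_w0 flip: times_divide_eq_right)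
  qed
  ultimately have "wt M N t x * Wt M N t y = of_real (sqrt (w0 M N x) / sqrt x) / csqrt (t - of_real x)
      * (of_real (sqrt y * sqrt (w0 M N y)) * csqrt (t - of_real y))"
    by (simp only: wt_eq Wt_def)
  then show ?thesis
    unfolding csqrt_conv_powr by simp
qed

lemma epsop_add:
  assumes "N < M"
  shows "epsop (\<lambda>z. pc (p + q) z * wt M N t z) y
    = epsop (\<lambda>z. pc p z * wt M N t z) y + epsop (\<lambda>z. pc q z * wt M N t z) y"
proof -
  have int: "set_integrable lborel {0<..} (\<lambda>z. of_real (epsf (y - z)) * (pc p z * wt M N t z))" for p
    unfolding set_integrable_def
  proof (rule Bochner_Integration.integrable_bound[OF integrable_pc_wt[OF assms, of p t, unfolded set_integrable_def]])
    show "AE z in lborel. norm (indicat_real {0<..} z *\<^sub>R (of_real (epsf (y - z)) * (pc p z * wt M N t z)))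
       \<le> norm (indicat_real {0<..} z *\<^sub>R (pc p z * wt M N t z))"
      by (intro AE_I2) (auto simp: indicator_def norm_mult epsf_def sgn_if intro!: mult_left_le_one_le)
  qed measurable
  show ?thesis
    unfolding epsop_def pc_add distrib_right distrib_left by (intro set_integral_add int)
qed

lemma epsop_smult:
  "epsop (\<lambda>z. pc (smult c p) z * wt M N t z) y = c * epsop (\<lambda>z. pc p z * wt M N t z) y"
  unfolding epsop_def pc_smult mult.assoc mult.left_commute[of _ c] by simp

section \<open>From the polynomial identity to the kernels\<close>

theorem theorem4:
  fixes N M :: nat and t :: complex and L :: "nat \<Rightarrow> real poly"
    and r :: "complex \<Rightarrow> nat \<Rightarrow> complex poly" and mu :: "nat \<Rightarrow> nat \<Rightarrow> complex"
    and x y :: real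
  assumes "0 < N" and "N < M" and "even N"
    and "monic_orth_family M N L"
    and "skew1 M N t (Lc L (N - 1)) (Lc L (N - 2)) * skew1 M N t (Lc L (N - 3)) (Lc L (N - 4)) \<noteq> 0"
    and "\<forall>j<N. degree (r t j) = j \<and> lead_coeff (r t j) = 1"
    and "\<forall>j<N - 2. \<forall>s s'. r s j = r s' j"
    and "is_pi1 M N t (N - 2) (r t (N - 2))"
    and "is_pi1 M N t (N - 1) (r t (N - 1))"
    and "\<forall>j<N. \<forall>k<N. (\<Sum>l<N. DD M N t (r t) j l * mu l k) = (if j = k then 1 else 0)"
    and "\<forall>j<N. \<forall>k<N. (\<Sum>l<N. mu j l * DD M N t (r t) l k) = (if j = k then 1 else 0)"
    and "0 < x" and "0 < y" and "x \<noteq> y"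
    and "complex_of_real x \<noteq> t" and "complex_of_real y \<noteq> t"
  shows "S1 M N t (r t) mu x y - K2 M N t L x y =
      - (of_nat M / (2 * of_real (h0 M N L (N - 2))))
          * epsop (\<lambda>z. piN M N t L z * wt M N t z) y * Lc L (N - 2) x * wt M N t x
      + ( - (of_nat M / (2 * of_real (h0 M N L (N - 1))))
            * epsop (\<lambda>z. piN1 M N t L z * wt M N t z) y
          + (of_nat M * t - of_nat (M + N)) / (2 * of_real (h0 M N L (N - 1)))
            * epsop (\<lambda>z. piN M N t L z * wt M N t z) y)
        * Lc L (N - 1) x * wt M N t x"
proof -
  have NM: "N < M" and x: "0 < x" and y: "0 < y" by fact+
  have N2: "2 \<le> N" using assms(1,3) by (auto elim!: evenE)
  have L: "degree (L k) = k" "coeff (L k) k = 1" for k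
    using assms(4) unfolding monic_orth_family_def by metis+
  then have L_nz: "L k \<noteq> 0" for k by (metis coeff_0 zero_neq_one)
  define h where "h = (\<lambda>k. complex_of_real (h0 M N L k))"
  interpret skew_orthogonal_setting "I0 M N" "\<lambda>p q. skew1 M N t (pc p) (pc q)" "DW M N t" "LC L" h M N t
  proof
    show "degree (LC L k) = k" "coeff (LC L k) k = 1" for k
      using L by (simp_all add: LC_def degree_map_poly coeff_map_poly)
    show "I0 M N (LC L k * q) = 0" if "degree q < k" for q k
      by (rule I0_LC_orth[OF NM assms(4) that])
    show "h k \<noteq> 0" for k
      using h0_nonzero[OF NM L_nz] by (simp add: h_def)
    show "I0 M N (LC L k * LC L k) = h k" for k
      by (simp only: I0_LC_LC h_def)
  qed (rule I0_add[OF NM] I0_smult skew1_add_left[OF NM] skew1_smult_left[OF NM] skew1_skew[OF NM]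
      DW_def skew1_DW[OF NM] I0_Stein[OF NM] N2 | use NM in simp)+
  define E where "E = (\<lambda>p. epsop (\<lambda>z. pc p z * wt M N t z) y)"
  define R where "R = r t"
  \<comment> \<open>\<open>S1\<close> divided by \<open>w(x)\<close>, as a polynomial in
    \<open>x\<close>.\<close>
  define P where "P = - (\<Sum>j<N. \<Sum>k<N. smult (mu j k * E (R k)) (R j))"
  have R: "degree (R j) = j" "coeff (R j) j = 1" if "j < N" for j
    using assms(6) that by (auto simp: R_def)
  have S1: "S1 M N t (r t) mu x y = pc P x * wt M N t x"
  proof -
    have "pc P x = - (\<Sum>j<N. \<Sum>k<N. mu j k * E (R k) * pc (R j) x)"
      by (simp add: P_def pc_def poly_sum)
    then show ?thesis
      by (simp add: S1_def E_def R_def sum_distrib_left mult_ac)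
  qed
  have P_degree: "degree P < N"
    unfolding P_def degree_minus using N2 R
    by (intro degree_sum_less) (auto intro: le_less_trans[OF degree_smult_le])
  \<comment> \<open>After exchanging the sums the inner one is an entry of the product of
    \<open>DD\<close> and \<open>mu\<close>, so only the term \<open>k = l\<close> remains.\<close>
  have B_R_P: "skew1 M N t (pc (R l)) (pc P) = - E (R l)" if l: "l < N" for l
  proof -
    have "skew1 M N t (pc (R l)) (pc P) = - (\<Sum>j<N. \<Sum>k<N. mu j k * E (R k) * DD M N t R l j)"
      by (simp add: P_def B_minus_right B_sum_right B_smult_right DD_def)
    also have "\<dots> = - (\<Sum>k<N. E (R k) * (\<Sum>j<N. DD M N t R l j * mu j k))"
      unfolding sum_distrib_left by (subst sum.swap) (simp add: mult_ac)
    also have "\<dots> = - (\<Sum>k<N. if k = l then E (R k) else 0)"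
      using assms(10) l by (intro arg_cong[of _ _ uminus] sum.cong) (auto simp: R_def)
    finally show ?thesis using l by simp
  qed
  have E_add: "E (p + q) = E p + E q" and E_smult: "E (smult c p) = c * E p" for p q c
    by (simp_all add: E_def epsop_add[OF NM] epsop_smult)
  have B_P: "skew1 M N t (pc p) (pc P) = - E p" if "degree p < N" for p
  proof -
    have "skew1 M N t (pc p) (pc P) + E p = 0"
      by (rule linear_functional_eq_0_monic_basis[where R = R and n = N
            and F = "\<lambda>p. skew1 M N t (pc p) (pc P) + E p"])
         (use that R in \<open>auto simp: B_add_left B_smult_left E_add E_smult B_R_P\<close>)
    then show ?thesis by (simp add: add_eq_0_iff)
  qed
  have nz: "skew1 M N t (pc (LC L (N - 1))) (pc (LC L (N - 2))) \<noteq> 0"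
    using assms(5) by (simp add: pc_LC)
  have P: "P = smult (Wt M N t y) (kernel (of_real y))
    + smult (- of_nat M / (2 * h (N - 2)) * E pi_even) (LC L (N - 2))
    + smult (- of_nat M / (2 * h (N - 1)) * E pi_odd
        + (of_nat M * t - of_nat (M + N)) / (2 * h (N - 1)) * E pi_even) (LC L (N - 1))"
    by (rule kernel_unique[OF nz E_add E_smult _ P_degree B_P])
       (use epsop_DW[OF NM] y in \<open>simp_all add: E_def pc_def mult.commute\<close>)
  \<comment> \<open>The Christoffel-Darboux formula evaluated at \<open>x\<close>, divided by
    \<open>x - y\<close>, which is nonzero.\<close>
  have K2: "K2 M N t L x y = Wt M N t y * pc (kernel (of_real y)) x * wt M N t x"
  proof -
    have "poly ([:- of_real y, 1:] * kernel (of_real y)) (of_real x)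
        = 1 / h (N - 1) * (pc (LC L (N - 1)) y * pc (LC L N) x - pc (LC L N) y * pc (LC L (N - 1)) x)"
      unfolding Christoffel_Darboux by (simp add: pc_def)
    then have "(of_real x - of_real y) * pc (kernel (of_real y)) x
        = 1 / h (N - 1) * (Lc L (N - 1) y * Lc L N x - Lc L N y * Lc L (N - 1) x)"
      by (simp add: pc_LC pc_def left_diff_distrib)
    then have "pc (kernel (of_real y)) x = of_real ((poly (L N) x * poly (L (N - 1)) y
        - poly (L N) y * poly (L (N - 1)) x) / (h0 M N L (N - 1) * (x - y)))"
      using assms(14) h_nonzero[of "N - 1"] by (simp add: h_def Lc_def field_simps)
    moreover have "K2 M N t L x y = (of_real (sqrt y) * (t - of_real y) powr (1 / 2))
        / (of_real (sqrt x) * (t - of_real x) powr (1 / 2)) * of_real (sqrt (w0 M N x) * sqrt (w0 M N y))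
        * of_real ((poly (L N) x * poly (L (N - 1)) y
        - poly (L N) y * poly (L (N - 1)) x) / (h0 M N L (N - 1) * (x - y)))"
      unfolding K2_def by simp
    ultimately show ?thesis
      unfolding K2_prefactor[OF x y NM] by (simp add: mult_ac)
  qed
  have pi: "piN M N t L = pc pi_even" "piN1 M N t L = pc pi_odd"
    by (rule ext; simp add: piN_def piN1_def pi_even_def pi_odd_def pc_add pc_diff pc_smult pc_LC)+
  have "S1 M N t (r t) mu x y - K2 M N t L x y = (- of_nat M / (2 * h (N - 2)) * E pi_even * Lc L (N - 2) x
    + (- of_nat M / (2 * h (N - 1)) * E pi_odd
        + (of_nat M * t - of_nat (M + N)) / (2 * h (N - 1)) * E pi_even) * Lc L (N - 1) x) * wt M N t x"
    unfolding S1 K2 by (subst P) (simp only: pc_add pc_smult pc_LC, simp only: algebra_simps)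
  moreover have "epsop (\<lambda>z. pc p z * wt M N t z) y = E p" "of_real (h0 M N L k) = h k" for p k
    by (simp_all add: E_def h_def)
  ultimately show ?thesis
    by (simp only: pi) (simp add: algebra_simps)
qed

end
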